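(* Let $S$ be a finite axial subset of $\mathbb R^3_{\ge0}$ in general position. Then the Minkowski--Voronoi complex $MV(S)$ admits a canonical diagram.
   Context: A set $S\subset\mathbb R^3_{\ge0}$ is axial if it contains points on each coordinate axis. An axial $S$ is in general position if (i) each coordinate plane contains exactly $2$ points of $S$, none at the origin, lying on different coordinate axes, and (ii) every other plane parallel to a coordinate plane contains at most one point of $S$. For finite $A\subset\mathbb R^3_{\ge0}$ let $\Pi(A)=\{x: 0\le x_i\le \max_{y\in A} y_i,\ i=1,2,3\}$. A point $\gamma\in S$ is a Voronoi relative minimum if $\Pi(\{\gamma\})$ contains no point of $S\setminus\{\gamma\}$; $\mathrm{vrm}(S)$ is the set of them. A finite $F\subset\mathrm{vrm}(S)$ is minimal if $\Pi(F)$ contains no point of $\mathrm{vrm}(S)\setminus F$; $\mathfrak M_k(S)$ is the set of minimal $k$-element subsets. $MV(S)$ is the complex whose vertices are the elements of $\mathfrak M_3(S)$, edges are the elements of $\mathfrak M_2(S)$, faces are the elements of $\mathfrak M_1(S)$, with incidence given by inclusion. An edge $E\in\mathfrak M_2(S)$ contained in two vertices is finite (joins them); an edge contained in only one vertex is infinite. Labels: if $V=\{\gamma_1,\gamma_2,\gamma_3\}$ and $V'=\{\gamma_1,\gamma_2,\gamma_3'\}$ are vertices joined by the edge $\{\gamma_1,\gamma_2\}$, then passing from $\Pi(V)$ to $\Pi(V')$ exactly one of the three coordinate sizes (maximal $x$-, $y$-, $z$-coordinates) increases, one decreases and one stays unchanged. With $e_1=(-\tfrac12,\tfrac{\sqrt3}2)$,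 $e_2=(\tfrac12,\tfrac{\sqrt3}2)$, $e_3=(1,0)$, the direction (label) of the edge from $V$ to $V'$ is: $e_1$ if $z$ increases and $y$ decreases; $-e_1$ if $y$ increases and $z$ decreases; $e_2$ if $z$ increases and $x$ decreases; $-e_2$ if $x$ increases and $z$ decreases; $e_3$ if $y$ increases and $x$ decreases; $-e_3$ if $x$ increases and $y$ decreases. A canonical diagram of $S$ is an embedding of the 1-skeleton of $MV(S)$ into the plane (distinct vertices to distinct points, edges pairwise meeting only at common endpoints) in which every finite edge from $V$ to $V'$ is a straight segment from the image of $V$ to the image of $V'$ that is a positive multiple of the label of the edge from $V$ to $V'$, and every infinite edge is a straight ray emanating from the image of its unique vertex.
   Formalization: The vertices of MV(S) are taken to be only those minimal triples all of whose 2-element subsets are minimal; with all of M_3(S), an edge such as {(1,2,2),(2,1,1)} together with three axis points at distance 3 would lie in three vertices, being neither finite nor infinite. *)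

theory Defs
  imports "HOL-Analysis.Analysis"
begin

text \<open>Coordinates \<open>x, y, z\<close> of \<open>real ^ 3\<close> have indices \<open>1, 2, 3\<close>. The \<open>i\<close>-th coordinate axis is
  \<open>range (axis i)\<close>, the \<open>i\<close>-th coordinate plane is \<open>{p. p $ i = 0}\<close>.\<close>

definition nonneg_orthant :: "(real ^ 3) set" where
  "nonneg_orthant = {p. \<forall>i. 0 \<le> p $ i}"

definition axial :: "(real ^ 3) set \<Rightarrow> bool" where
  "axial S \<longleftrightarrow> (\<forall>i. \<exists>p\<in>S. p \<in> range (axis i))"

definition general_position :: "(real ^ 3) set \<Rightarrow> bool" where
  "general_position S \<longleftrightarrow>
     (\<forall>i. \<exists>p q j k. {r \<in> S. r $ i = 0} = {p, q} \<and> p \<noteq> q \<and> p \<noteq> 0 \<and> q \<noteq> 0 \<and>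
            j \<noteq> k \<and> p \<in> range (axis j) \<and> q \<in> range (axis k)) \<and>
     (\<forall>i c. c \<noteq> 0 \<longrightarrow> (\<forall>p\<in>S. \<forall>q\<in>S. p $ i = c \<and> q $ i = c \<longrightarrow> p = q))"

text \<open>Only meaningful for finite nonempty \<open>A\<close>.\<close>

definition extent :: "(real ^ 3) set \<Rightarrow> 3 \<Rightarrow> real" where
  "extent A i = Max ((\<lambda>p. p $ i) ` A)"

definition Pi_box :: "(real ^ 3) set \<Rightarrow> (real ^ 3) set" where
  "Pi_box A = {p. \<forall>i. 0 \<le> p $ i \<and> p $ i \<le> extent A i}"

definition vrm :: "(real ^ 3) set \<Rightarrow> (real ^ 3) set" where
  "vrm S = {\<gamma> \<in> S. Pi_box {\<gamma>} \<inter> (S - {\<gamma>}) = {}}"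

definition minimal_set :: "(real ^ 3) set \<Rightarrow> (real ^ 3) set \<Rightarrow> bool" where
  "minimal_set S F \<longleftrightarrow> finite F \<and> F \<subseteq> vrm S \<and> Pi_box F \<inter> (vrm S - F) = {}"

definition minimal_sets :: "nat \<Rightarrow> (real ^ 3) set \<Rightarrow> (real ^ 3) set set" where
  "minimal_sets k S = {F. minimal_set S F \<and> card F = k}"

text \<open>A minimal triple may contain a non-minimal pair: if one of its points lies in the box of
  the other two, that point contributes nothing to the box of the triple and the pair of the other
  two is not minimal. For example, with \<open>S\<close> consisting of \<open>p = (1,2,2)\<close>, \<open>q = (2,1,1)\<close>, \<open>X = (3,0,0)\<close>,
  \<open>Y = (0,3,0)\<close>, \<open>Z = (0,0,3)\<close>, the triple \<open>{p, q, X}\<close> is minimal and \<open>{p, X}\<close> is not; counting this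
  triple as a vertex would put the edge \<open>{p, q}\<close> into three vertices. A complex
  contains with each cell its boundary, so the vertices of the Minkowski--Voronoi complex are the
  minimal triples all of whose pairs are edges, that is, those whose three points each lie on a
  different outer face of the box. With this, every edge has one or two vertices.\<close>

definition MV_edges :: "(real ^ 3) set \<Rightarrow> (real ^ 3) set set" where
  "MV_edges S = minimal_sets 2 S"

definition MV_vertices :: "(real ^ 3) set \<Rightarrow> (real ^ 3) set set" where
  "MV_vertices S = {V \<in> minimal_sets 3 S. \<forall>E\<subseteq>V. card E = 2 \<longrightarrow> E \<in> MV_edges S}"

definition ends :: "(real ^ 3) set \<Rightarrow> (real ^ 3) set \<Rightarrow> (real ^ 3) set set" where
  "ends S E = {V \<in> MV_vertices S. E \<subseteq> V}"

definition finite_edge ::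
    "(real ^ 3) set \<Rightarrow> (real ^ 3) set \<Rightarrow> (real ^ 3) set \<Rightarrow> (real ^ 3) set \<Rightarrow> bool" where
  "finite_edge S E V V' \<longleftrightarrow> E \<in> MV_edges S \<and> V \<noteq> V' \<and> ends S E = {V, V'}"

definition infinite_edge :: "(real ^ 3) set \<Rightarrow> (real ^ 3) set \<Rightarrow> (real ^ 3) set \<Rightarrow> bool" where
  "infinite_edge S E V \<longleftrightarrow> E \<in> MV_edges S \<and> ends S E = {V}"

text \<open>Passing from \<open>V\<close> to \<open>V'\<close>, size \<open>i\<close> increases, size \<open>j\<close> decreases, all others stay unchanged.\<close>

definition exchange :: "3 \<Rightarrow> 3 \<Rightarrow> (real ^ 3) set \<Rightarrow> (real ^ 3) set \<Rightarrow> bool" where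
  "exchange i j V V' \<longleftrightarrow> extent V i < extent V' i \<and> extent V' j < extent V j \<and>
     (\<forall>k. k \<noteq> i \<and> k \<noteq> j \<longrightarrow> extent V' k = extent V k)"

definition e1 :: "real ^ 2" where "e1 = vector [- 1 / 2, sqrt 3 / 2]"
definition e2 :: "real ^ 2" where "e2 = vector [1 / 2, sqrt 3 / 2]"
definition e3 :: "real ^ 2" where "e3 = vector [1, 0]"

text \<open>The value \<open>0\<close> in the last case is not a label; no drawing with distinct vertices can have it.\<close>

definition label :: "(real ^ 3) set \<Rightarrow> (real ^ 3) set \<Rightarrow> real ^ 2" where
  "label V V' =
     (if exchange 3 2 V V' then e1
      else if exchange 2 3 V V' then - e1
      else if exchange 3 1 V V' then e2
      else if exchange 1 3 V V' then - e2
      else if exchange 2 1 V V' then e3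
      else if exchange 1 2 V V' then - e3
      else 0)"

definition ray :: "real ^ 2 \<Rightarrow> real ^ 2 \<Rightarrow> (real ^ 2) set" where
  "ray a d = (\<lambda>t. a + t *\<^sub>R d) ` {0..}"

text \<open>\<open>f\<close> gives the images of the vertices and \<open>D\<close> those of the edges.\<close>

definition canonical_diagram ::
    "(real ^ 3) set \<Rightarrow> ((real ^ 3) set \<Rightarrow> real ^ 2) \<Rightarrow> ((real ^ 3) set \<Rightarrow> (real ^ 2) set) \<Rightarrow> bool" where
  "canonical_diagram S f D \<longleftrightarrow>
     inj_on f (MV_vertices S) \<and>
     (\<forall>E\<in>MV_edges S. (\<exists>V V'. finite_edge S E V V') \<or> (\<exists>V. infinite_edge S E V)) \<and>
     (\<forall>E V V'. finite_edge S E V V' \<longrightarrow>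
        D E = closed_segment (f V) (f V') \<and> (\<exists>t>0. f V' - f V = t *\<^sub>R label V V')) \<and>
     (\<forall>E V. infinite_edge S E V \<longrightarrow> (\<exists>d. d \<noteq> 0 \<and> D E = ray (f V) d)) \<and>
     (\<forall>E\<in>MV_edges S. \<forall>V\<in>MV_vertices S. f V \<in> D E \<longrightarrow> V \<in> ends S E) \<and>
     (\<forall>E\<in>MV_edges S. \<forall>E'\<in>MV_edges S. E \<noteq> E' \<longrightarrow> D E \<inter> D E' \<subseteq> f ` (ends S E \<inter> ends S E'))"

end

theory Submission
  imports Defs
begin

text \<open>Sweep the points of \<^term>\<open>vrm S\<close> by increasing \<open>z\<close>. The points swept so far form a staircase in the
  \<open>x\<close>-\<open>y\<close>-projection; each pair of consecutive steps is a strand of the drawing that moves upwards,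
  in direction \<open>e1\<close> or \<open>e2\<close> according to which of its two points came later. A new point \<open>p\<close> cuts
  off some consecutive strands: their ends are the vertices in which \<open>p\<close> has the largest \<open>z\<close>, they are
  joined by horizontal edges, and two new strands start, in direction \<open>e1\<close> from the leftmost and in
  direction \<open>e2\<close> from the rightmost of these vertices. Directions are thus correct whatever the
  heights of the events are. Neighbouring strands may converge, but they have positive distance
  right after every event (or diverge from a common vertex), so they never meet if the next event
  takes place soon enough.\<close>

subsection \<open>Active strands\<close>

text \<open>A vertex is a triple \<open>{a, b, p}\<close> whose points realise the
  \<open>x\<close>-, \<open>y\<close>- and \<open>z\<close>-size of its box, and a finite edge keeps
  one of the three sizes. So the drawing is an arrangement of lines: in oblique coordinates
  \<open>(u, h)\<close> with respect to \<open>e3\<close> and \<open>e2\<close>, the vertices with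
  \<open>x\<close>-size from \<open>a\<close> lie on \<open>u + h = - \<phi>\<^sub>1 a\<close>,
  those with \<open>y\<close>-size from \<open>b\<close> on \<open>u = \<phi>\<^sub>2 b\<close>,
  those with \<open>z\<close>-size from \<open>p\<close> on \<open>h = hgt (\<rho> p)\<close>.
  Concurrency at the vertex is the equation
  \<open>\<phi>\<^sub>1 a + \<phi>\<^sub>2 b + hgt (\<rho> p) = 0\<close>. Solving this system gives
  a closed formula for the abscissa of a strand at every height, in place of starting points carried
  along the sweep. Edges are then parallel to their labels. The remaining obstacle, that edges meet
  only at vertices, is treated on one horizontal line at a time: active strands must have distinct
  abscissae, and at the height of an event the horizontal edges fill the gaps between consecutive
  killed strands.\<close>

locale sweep =
  fixes P :: "'a set" and x y :: "'a \<Rightarrow> real" and \<rho> :: "'a \<Rightarrow> nat" and X Y Z :: 'a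
  assumes finite_P: "finite P"
    and mem: "X \<in> P" "Y \<in> P" "Z \<in> P"
    and X_neq_Y: "X \<noteq> Y"
    and x_tie: "\<lbrakk>a \<in> P; b \<in> P; x a = x b\<rbrakk> \<Longrightarrow> a = b \<or> {a, b} = {Y, Z}"
    and y_tie: "\<lbrakk>a \<in> P; b \<in> P; y a = y b\<rbrakk> \<Longrightarrow> a = b \<or> {a, b} = {X, Z}"
    and x_less_X: "\<lbrakk>a \<in> P; a \<noteq> X\<rbrakk> \<Longrightarrow> x a < x X"
    and y_less_Y: "\<lbrakk>a \<in> P; a \<noteq> Y\<rbrakk> \<Longrightarrow> y a < y Y"
    and x_Z_le: "a \<in> P \<Longrightarrow> x Z \<le> x a"
    and y_Z_le: "a \<in> P \<Longrightarrow> y Z \<le> y a"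
    and x_Y: "x Y = x Z"
    and y_X: "y X = y Z"
    and rank_X [simp]: "\<rho> X = 0"
    and rank_Y [simp]: "\<rho> Y = 0"
    and rank_tie: "\<lbrakk>a \<in> P; b \<in> P; \<rho> a = \<rho> b\<rbrakk> \<Longrightarrow> a = b \<or> {a, b} = {X, Y}"
    and rank_less_Z: "\<lbrakk>a \<in> P; a \<noteq> Z\<rbrakk> \<Longrightarrow> \<rho> a < \<rho> Z"
    and antichain: "\<lbrakk>a \<in> P; b \<in> P; x a \<le> x b; y a \<le> y b; \<rho> a \<le> \<rho> b\<rbrakk> \<Longrightarrow> a = b"
begin

text \<open>At time \<open>t\<close> the points of rank at most \<open>t\<close> have been swept. The minimal elements of their
  projections to the \<open>x\<close>-\<open>y\<close>-plane form a staircase, and the active strands are the pairs of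
  consecutive steps \<open>(a, b)\<close>, ordered from \<open>X\<close> to \<open>Y\<close>. A new point \<open>p\<close> kills the strands whose
  corner lies above it; these triples \<open>{a, b, p}\<close> turn out to be the vertices of the complex.\<close>

definition strand :: "'a \<Rightarrow> 'a \<Rightarrow> bool" where
  "strand a b \<longleftrightarrow> a \<in> P \<and> b \<in> P \<and> a \<noteq> b \<and> x b \<le> x a \<and> y a \<le> y b"

definition act :: "nat \<Rightarrow> 'a \<times> 'a \<Rightarrow> bool" where
  "act t s \<longleftrightarrow> strand (fst s) (snd s) \<and> \<rho> (fst s) \<le> t \<and> \<rho> (snd s) \<le> t \<and>
     (\<forall>c\<in>P. \<rho> c \<le> t \<longrightarrow> x c \<le> x (fst s) \<longrightarrow> y c \<le> y (snd s) \<longrightarrow> c = fst s \<or> c = snd s)"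

text \<open>Compares the corners \<open>(x a, y b)\<close>: on the way from \<open>X\<close> to
  \<open>Y\<close> a corner moves left and up. Among strands active at a common time this is a
  linear order.\<close>

definition le :: "'a \<times> 'a \<Rightarrow> 'a \<times> 'a \<Rightarrow> bool" where
  "le s s' \<longleftrightarrow> x (fst s') \<le> x (fst s) \<and> y (snd s) \<le> y (snd s')"

definition killed :: "'a \<times> 'a \<Rightarrow> 'a \<Rightarrow> bool" where
  "killed s p \<longleftrightarrow> p \<in> P \<and> 0 < \<rho> p \<and> act (\<rho> p - 1) s \<and> x p \<le> x (fst s) \<and> y p \<le> y (snd s)"

lemma Z_neq: "Z \<noteq> X" "Z \<noteq> Y" "0 < \<rho> Z"
  using rank_less_Z[OF mem(1)] rank_less_Z[OF mem(2)] X_neq_Y by (cases "Z = X"; force)+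

lemma xy_inj: "\<lbrakk>a \<in> P; b \<in> P; x a = x b; y a = y b\<rbrakk> \<Longrightarrow> a = b"
  using x_tie y_tie X_neq_Y by (metis doubleton_eq_iff)

lemma rank_zero: "\<lbrakk>a \<in> P; \<rho> a = 0\<rbrakk> \<Longrightarrow> a = X \<or> a = Y"
  using rank_tie[of a X] mem by (auto simp: doubleton_eq_iff)

lemma rank_inj: "\<lbrakk>a \<in> P; b \<in> P; \<rho> a = \<rho> b; 0 < \<rho> a\<rbrakk> \<Longrightarrow> a = b"
  using rank_tie[of a b] by (auto simp: doubleton_eq_iff)

lemma strand_antisym: "strand a b \<Longrightarrow> \<not> strand b a"
  using xy_inj unfolding strand_def by (metis order_antisym)

lemma strand_neq: assumes "strand a b" shows "a \<noteq> Y" "b \<noteq> X"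
  using assms x_less_X y_less_Y unfolding strand_def by (metis not_less)+

lemma act_D:
  assumes "act t (a, b)"
  shows "strand a b" "a \<in> P" "b \<in> P" "a \<noteq> b" "x b \<le> x a" "y a \<le> y b" "\<rho> a \<le> t" "\<rho> b \<le> t"
    "\<And>c. \<lbrakk>c \<in> P; \<rho> c \<le> t; x c \<le> x a; y c \<le> y b\<rbrakk> \<Longrightarrow> c = a \<or> c = b"
  using assms unfolding act_def strand_def by auto

lemma act_I:
  assumes "strand a b" "\<rho> a \<le> t" "\<rho> b \<le> t"
    "\<And>c. \<lbrakk>c \<in> P; \<rho> c \<le> t; x c \<le> x a; y c \<le> y b\<rbrakk> \<Longrightarrow> c = a \<or> c = b"
  shows "act t (a, b)"
  using assms unfolding act_def by auto

lemma act_mono: "\<lbrakk>act t s; \<rho> (fst s) \<le> r; \<rho> (snd s) \<le> r; r \<le> t\<rbrakk> \<Longrightarrow> act r s"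
  unfolding act_def by (meson order_trans)

text \<open>If the corner of one strand were strictly smaller in both coordinates, both of its
  points would lie in the empty box of the other strand, so it would be that strand
  reversed.\<close>

lemma le_total:
  assumes "act t s" "act t s'" shows "le s s' \<or> le s' s"
proof (rule ccontr)
  obtain a b a' b' where s: "s = (a, b)" "s' = (a', b')" by (cases s, cases s')
  note A = act_D[OF assms(1)[unfolded s]] act_D[OF assms(2)[unfolded s]]
  assume "\<not> ?thesis"
  then consider "x a' < x a" "y b' < y b" | "x a < x a'" "y b < y b'"
    unfolding le_def s by fastforce
  then show False
  proof cases
    case 1
    then have "a' = a \<or> a' = b" "b' = a \<or> b' = b"
      using A(9)[of a'] A(9)[of b'] A by (meson le_less_trans less_imp_le order_trans)+
    then show False using A(1-8,10-17) 1 strand_antisym[of a b] by auto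
  next
    case 2
    then have "a = a' \<or> a = b'" "b = a' \<or> b = b'"
      using A(18)[of a] A(18)[of b] A by (meson le_less_trans less_imp_le order_trans)+
    then show False using A(1-8,10-17) 2 strand_antisym[of a b] by auto
  qed
qed

text \<open>Overlapping strands would have points in each other's boxes, where an active strand
  admits only its own two points; for distinct strands this is contradictory.\<close>

lemma le_strong:
  assumes "act t (a, b)" "act t (a', b')" "le (a, b) (a', b')" "(a, b) \<noteq> (a', b')"
  shows "y b \<le> y a'" "x a' \<le> x b"
proof -
  note A = act_D[OF assms(1)] act_D[OF assms(2)]
  have l: "x a' \<le> x a" "y b \<le> y b'" using assms(3) by (auto simp: le_def)
  have "y b \<le> y a' \<and> x a' \<le> x b"
  proof (cases "y b' \<le> y b")
    case True
    then have "a' = a \<or> a' = b" "b' = a \<or> b' = b"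
      using A(9)[of a'] A(9)[of b'] A l by (meson order_trans)+
    then have "a' = b" "b' = a" using A assms(4) by auto
    then show ?thesis using A strand_antisym by auto
  next
    case False
    have "y b \<le> y a'"
    proof (rule ccontr)
      assume n: "\<not> ?thesis"
      then have "a' = a \<or> a' = b" using A(9)[of a'] A l by auto
      then have "a' = a" using n by auto
      then have "b = a' \<or> b = b'" using A(18)[of b] A l by auto
      then show False using n A(4) \<open>a' = a\<close> False by auto
    qed
    moreover have "x a' \<le> x b"
    proof (rule ccontr)
      assume n: "\<not> ?thesis"
      then have "b = a' \<or> b = b'" using A(18)[of b] A l by auto
      then show False using n False by auto
    qed
    ultimately show ?thesis by simp
  qed
  then show "y b \<le> y a'" "x a' \<le> x b" by auto
qed

lemma le_antisym:
  assumes "act t s" "act t s'" "le s s'" "le s' s" shows "s = s'"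
proof (rule ccontr)
  obtain a b a' b' where s: "s = (a, b)" "s' = (a', b')" by (cases s, cases s')
  assume "s \<noteq> s'"
  then have "y b \<le> y a'" "x a' \<le> x b" "y b' \<le> y a" "x a \<le> x b'"
    using le_strong[of t a b a' b'] le_strong[of t a' b' a b] assms s by auto
  then show False
    using act_D[of t a b] act_D[of t a' b'] assms s xy_inj[of a b] by auto
qed

text \<open>The inequalities become strict because ties in \<open>x\<close> or \<open>y\<close>
  involve \<open>Z\<close> together with \<open>Y\<close> or \<open>X\<close>. Both \<open>a\<close>
  and \<open>b\<close> rank below \<open>p\<close>, so neither is \<open>Z\<close>, and
  \<open>p\<close> has positive rank, so it is neither \<open>X\<close> nor \<open>Y\<close>;
  \<open>strand_neq\<close> excludes the rest.\<close>

lemma killed_D: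
  assumes "killed (a, b) p"
  shows "act (\<rho> p - 1) (a, b)" "a \<in> P" "b \<in> P" "p \<in> P" "0 < \<rho> p" "a \<noteq> b" "a \<noteq> p" "b \<noteq> p"
    "\<rho> a < \<rho> p" "\<rho> b < \<rho> p" "x p < x a" "y p < y b" "x b < x a" "y a < y b" "strand a b"
proof -
  show act: "act (\<rho> p - 1) (a, b)" and "p \<in> P" "0 < \<rho> p" using assms by (auto simp: killed_def)
  note A = act_D[OF act]
  show "a \<in> P" "b \<in> P" "a \<noteq> b" "strand a b" using A by auto
  show r: "\<rho> a < \<rho> p" "\<rho> b < \<rho> p" using A \<open>0 < \<rho> p\<close> by auto
  then show np: "a \<noteq> p" "b \<noteq> p" by auto
  have "p \<noteq> Y" "p \<noteq> X" "a \<noteq> Y" "b \<noteq> X" using \<open>0 < \<rho> p\<close> strand_neq[OF A(1)] by auto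
  moreover have "a \<noteq> Z" "b \<noteq> Z" using r rank_less_Z[OF \<open>p \<in> P\<close>] by (metis order_less_asym less_irrefl)+
  ultimately have "x p \<noteq> x a" "y p \<noteq> y b" "x b \<noteq> x a" "y a \<noteq> y b"
    using x_tie[of p a] y_tie[of p b] x_tie[of b a] y_tie[of a b] A \<open>p \<in> P\<close> np
    by (auto simp: doubleton_eq_iff)
  then show "x p < x a" "y p < y b" "x b < x a" "y a < y b"
    using A assms by (auto simp: killed_def)
qed

text \<open>At the time of a later killer the strand would still have to be active, although the
  earlier killer already lies in its box.\<close>

lemma killed_unique:
  assumes "killed s p" "killed s p'" shows "p = p'"
proof -
  obtain a b where s: "s = (a, b)" by (cases s)
  note K = killed_D[OF assms(1)[unfolded s]] killed_D[OF assms(2)[unfolded s]]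
  have False if "\<rho> p < \<rho> p'"
    using act_D(9)[OF K(16), of p] that K by fastforce
  moreover have False if "\<rho> p' < \<rho> p"
    using act_D(9)[OF K(1), of p'] that K by fastforce
  ultimately show ?thesis using rank_inj[of p p'] K by force
qed

section \<open>Neighbours, births and deaths of strands\<close>

lemma act_same_fst: assumes "act t (a, b)" "act t (a, b')" shows "b = b'"
proof (rule ccontr)
  assume "b \<noteq> b'"
  then consider "le (a, b) (a, b')" "(a, b) \<noteq> (a, b')" | "le (a, b') (a, b)" "(a, b') \<noteq> (a, b)"
    using le_total[OF assms] by auto
  then show False
    by cases (use le_strong assms act_D xy_inj in \<open>metis order_antisym\<close>)+
qed

lemma act_same_snd: assumes "act t (a, b)" "act t (a', b)" shows "a = a'"
proof (rule ccontr)
  assume "a \<noteq> a'"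
  then consider "le (a, b) (a', b)" "(a, b) \<noteq> (a', b)" | "le (a', b) (a, b)" "(a', b) \<noteq> (a, b)"
    using le_total[OF assms] by auto
  then show False
    by cases (use le_strong assms act_D xy_inj in \<open>metis order_antisym\<close>)+
qed

text \<open>The next step after \<open>a\<close> is the lowest swept point not to the right of
  \<open>a\<close>. There is one, since \<open>Y\<close> has rank 0 and the smallest
  \<open>x\<close>.\<close>

lemma act_extend_snd:
  assumes "a \<in> P" "a \<noteq> Y" "\<rho> a \<le> t"
    and y_less: "\<And>c. \<lbrakk>c \<in> P; \<rho> c \<le> t; x c \<le> x a; c \<noteq> a\<rbrakk> \<Longrightarrow> y a < y c"
  obtains c where "act t (a, c)"
proof -
  let ?C = "{c \<in> P. \<rho> c \<le> t \<and> x c \<le> x a \<and> c \<noteq> a}"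
  have "Y \<in> ?C" using assms x_Z_le[of a] x_Y mem by auto
  then have "finite ?C" "?C \<noteq> {}" using finite_P by auto
  then obtain c where c: "c \<in> ?C" and c_min: "\<And>d. d \<in> ?C \<Longrightarrow> y c \<le> y d"
    by (metis (no_types, lifting) arg_min_if_finite(1) arg_min_least)
  have "strand a c" using c assms by (auto simp: strand_def less_imp_le)
  moreover have "d = a \<or> d = c" if d: "d \<in> P" "\<rho> d \<le> t" "x d \<le> x a" "y d \<le> y c" for d
  proof (rule ccontr)
    assume n: "\<not> ?thesis"
    then have "y d = y c" using c_min[of d] d by auto
    then have "{d, c} = {X, Z}" using y_tie[of d c] d c n by auto
    then have "y c \<le> y a" using y_Z_le[of a] y_X assms by (auto simp: doubleton_eq_iff)
    then show False using y_less[of c] c by auto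
  qed
  ultimately show thesis using that act_I c assms by blast
qed

lemma act_extend_fst:
  assumes "b \<in> P" "b \<noteq> X" "\<rho> b \<le> t"
    and x_less: "\<And>c. \<lbrakk>c \<in> P; \<rho> c \<le> t; y c \<le> y b; c \<noteq> b\<rbrakk> \<Longrightarrow> x b < x c"
  obtains c where "act t (c, b)"
proof -
  let ?C = "{c \<in> P. \<rho> c \<le> t \<and> y c \<le> y b \<and> c \<noteq> b}"
  have "X \<in> ?C" using assms y_Z_le[of b] y_X mem by auto
  then have "finite ?C" "?C \<noteq> {}" using finite_P by auto
  then obtain c where c: "c \<in> ?C" and c_min: "\<And>d. d \<in> ?C \<Longrightarrow> x c \<le> x d"
    by (metis (no_types, lifting) arg_min_if_finite(1) arg_min_least)
  have "strand c b" using c assms by (auto simp: strand_def less_imp_le)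
  moreover have "d = c \<or> d = b" if d: "d \<in> P" "\<rho> d \<le> t" "x d \<le> x c" "y d \<le> y b" for d
  proof (rule ccontr)
    assume n: "\<not> ?thesis"
    then have "x d = x c" using c_min[of d] d by auto
    then have "{d, c} = {Y, Z}" using x_tie[of d c] d c n by auto
    then have "x c \<le> x b" using x_Z_le[of b] x_Y assms by (auto simp: doubleton_eq_iff)
    then show False using x_less[of c] c by auto
  qed
  ultimately show thesis using that act_I c assms by blast
qed

text \<open>Before \<open>p\<close>, the step after \<open>a\<close> was some \<open>c\<close>,
  which lies above \<open>p\<close>; so \<open>p\<close> kills \<open>(a, c)\<close>. With the
  mirrored lemma, every strand other than \<open>(X, Y)\<close> starts at a vertex.\<close>

lemma act_born_snd:
  assumes "act (\<rho> p) (a, p)" "0 < \<rho> p"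
  obtains c where "killed (a, c) p"
proof -
  note A = act_D[OF assms(1)]
  have "\<rho> a \<noteq> \<rho> p" using rank_inj[of p a] A assms(2) by auto
  then have ra: "\<rho> a \<le> \<rho> p - 1" using A by auto
  have less: "y p < y c" if "c \<in> P" "\<rho> c \<le> \<rho> p - 1" "x c \<le> x a" "c \<noteq> a" for c
    using A(9)[of c] that assms(2) by force
  obtain c where c: "act (\<rho> p - 1) (a, c)"
    using act_extend_snd[of a "\<rho> p - 1"] ra A strand_neq[OF A(1)] less by (metis le_less_trans)
  have "y p < y c" using less act_D[OF c] by blast
  then show thesis using that[of c] c A assms(2) by (auto simp: killed_def)
qed

lemma act_born_fst:
  assumes "act (\<rho> p) (p, b)" "0 < \<rho> p"
  obtains c where "killed (c, b) p"
proof -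
  note A = act_D[OF assms(1)]
  have "\<rho> b \<noteq> \<rho> p" using rank_inj[of p b] A assms(2) by auto
  then have rb: "\<rho> b \<le> \<rho> p - 1" using A by auto
  have less: "x p < x c" if "c \<in> P" "\<rho> c \<le> \<rho> p - 1" "y c \<le> y b" "c \<noteq> b" for c
    using A(9)[of c] that assms(2) by force
  obtain c where c: "act (\<rho> p - 1) (c, b)"
    using act_extend_fst[of b "\<rho> p - 1"] rb A strand_neq[OF A(1)] less by (metis le_less_trans)
  have "x p < x c" using less act_D[OF c] by blast
  then show thesis using that[of c] c A assms(2) by (auto simp: killed_def)
qed

text \<open>The killer is the point of least rank in the box. Applied to \<open>Z\<close>, which
  lies below every corner, this gives an upper end to each strand that does not contain
  \<open>Z\<close>.\<close>

lemma act_dies: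
  assumes "act t (a, b)" and d: "d \<in> P" "x d \<le> x a" "y d \<le> y b" "d \<noteq> a" "d \<noteq> b"
  obtains p where "killed (a, b) p" "t < \<rho> p" "\<rho> p \<le> \<rho> d"
proof -
  note A = act_D[OF assms(1)]
  let ?C = "{c \<in> P. x c \<le> x a \<and> y c \<le> y b \<and> c \<noteq> a \<and> c \<noteq> b}"
  have "d \<in> ?C" using d by auto
  moreover have "finite ?C" using finite_P by auto
  ultimately obtain p where p: "p \<in> ?C" and p_min: "\<And>d. d \<in> ?C \<Longrightarrow> \<rho> p \<le> \<rho> d"
    by (metis (no_types, lifting) arg_min_if_finite(1) arg_min_least empty_iff)
  have t: "t < \<rho> p" using A(9)[of p] p by force
  have "act (\<rho> p - 1) (a, b)"
    by (rule act_I) (use A t p_min in force)+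
  then show thesis using that[of p] p t p_min[OF \<open>d \<in> ?C\<close>] by (auto simp: killed_def)
qed

lemma not_act_if_killed: "killed s p \<Longrightarrow> \<rho> p \<le> t \<Longrightarrow> \<not> act t s"
  using killed_D[of "fst s" "snd s" p] act_D(9)[of t "fst s" "snd s" p] by auto

text \<open>By \<open>antichain\<close>, \<open>q\<close> comes before \<open>p\<close>, and it is a
  step of the staircase until \<open>p\<close> covers it. Then both strands meeting at
  \<open>q\<close> are killed; there are two because the strict inequalities exclude
  \<open>X\<close> and \<open>Y\<close>.\<close>

lemma horizontal_ends:
  assumes "p \<in> P" "q \<in> P" "x p < x q" "y p < y q"
    and box: "\<And>c. \<lbrakk>c \<in> P; \<rho> c \<le> \<rho> p; x c \<le> x q; y c \<le> y q\<rbrakk> \<Longrightarrow> c = p \<or> c = q"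
  obtains c d where "killed (c, q) p" "killed (q, d) p"
proof -
  have r: "\<rho> q < \<rho> p" using antichain[of p q] assms by fastforce
  then have rq: "\<rho> q \<le> \<rho> p - 1" "0 < \<rho> p" by auto
  have nq: "q \<noteq> Y" "q \<noteq> X"
    using assms x_Y y_X x_Z_le[of p] y_Z_le[of p] by auto
  have "y q < y c" if "c \<in> P" "\<rho> c \<le> \<rho> p - 1" "x c \<le> x q" "c \<noteq> q" for c
    using box[of c] that rq by force
  then obtain d where "act (\<rho> p - 1) (q, d)"
    using act_extend_snd[of q "\<rho> p - 1"] rq nq assms by metis
  moreover have "x q < x c" if "c \<in> P" "\<rho> c \<le> \<rho> p - 1" "y c \<le> y q" "c \<noteq> q" for c
    using box[of c] that rq by force
  then obtain c where "act (\<rho> p - 1) (c, q)"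
    using act_extend_fst[of q "\<rho> p - 1"] rq nq assms by metis
  ultimately show thesis
    using that[of c d] rq assms act_D[of "\<rho> p - 1" q d] act_D[of "\<rho> p - 1" c q]
    by (auto simp: killed_def)
qed

lemma killed_snd_unique: "killed (a, b) p \<Longrightarrow> killed (a, b') p \<Longrightarrow> b = b'"
  using act_same_fst killed_D(1) by blast

lemma killed_fst_unique: "killed (a, b) p \<Longrightarrow> killed (a', b) p \<Longrightarrow> a = a'"
  using act_same_snd killed_D(1) by blast

end

subsection \<open>Levels\<close>

text \<open>The increments halve, so strands that are apart at one event do not meet before the next one.\<close>

definition hgt :: "nat \<Rightarrow> real" where
  "hgt t = 1 - (1 / 2) ^ t"

lemma hgt_Suc: "hgt (Suc t) = hgt t + (1 / 2) ^ Suc t"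
  by (simp add: hgt_def)

lemma hgt_strict_mono: "strict_mono hgt"
  by (auto intro!: strict_mono_Suc_iff[THEN iffD2] simp: hgt_Suc)

lemma hgt_less_iff [simp]: "hgt s < hgt t \<longleftrightarrow> s < t"
  using hgt_strict_mono by (rule strict_mono_less)

lemma hgt_le_iff [simp]: "hgt s \<le> hgt t \<longleftrightarrow> s \<le> t"
  using hgt_strict_mono by (rule strict_mono_less_eq)

lemma hgt_eq_iff [simp]: "hgt s = hgt t \<longleftrightarrow> s = t"
  using hgt_strict_mono by (rule strict_mono_eq)

context sweep
begin

text \<open>A strand determines its killer, and the later point of an active strand determines the earlier
  one. So each new point occurs as \<open>a\<close> in at most one equation whose \<open>b\<close> has smaller rank, and
  symmetrically: the equations can be solved one rank at a time.\<close>

lemma levels_exist: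
  "\<exists>\<phi>\<^sub>1 \<phi>\<^sub>2 :: 'a \<Rightarrow> real. \<forall>a b p. killed (a, b) p \<longrightarrow> \<phi>\<^sub>1 a + \<phi>\<^sub>2 b + hgt (\<rho> p) = 0"
proof -
  have "\<exists>\<phi>\<^sub>1 \<phi>\<^sub>2 :: 'a \<Rightarrow> real. \<forall>a b p. killed (a, b) p \<longrightarrow> \<rho> a \<le> n \<longrightarrow> \<rho> b \<le> n \<longrightarrow>
          \<phi>\<^sub>1 a + \<phi>\<^sub>2 b + hgt (\<rho> p) = 0" for n
  proof (induction n)
    case 0
    have XY: "a = X \<and> b = Y" if "killed (a, b) p" "\<rho> a \<le> 0" "\<rho> b \<le> 0" for a b p
      using killed_D[OF that(1)] rank_zero that strand_neq[of a b] by blast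
    show ?case
    proof (cases "\<exists>p. killed (X, Y) p")
      case True
      then obtain p where p: "killed (X, Y) p" by blast
      have "killed (a, b) p' \<longrightarrow> \<rho> a \<le> 0 \<longrightarrow> \<rho> b \<le> 0 \<longrightarrow> - hgt (\<rho> p) + 0 + hgt (\<rho> p') = 0" for a b p'
        using XY[of a b p'] killed_unique[OF p, of p'] by auto
      then show ?thesis by (intro exI[of _ "\<lambda>_. - hgt (\<rho> p)"] exI[of _ "\<lambda>_. 0"]) blast
    next
      case False
      then show ?thesis using XY by blast
    qed
  next
    case (Suc n)
    then obtain \<phi>\<^sub>1 \<phi>\<^sub>2 :: "'a \<Rightarrow> real" where
      IH: "\<And>a b p. \<lbrakk>killed (a, b) p; \<rho> a \<le> n; \<rho> b \<le> n\<rbrakk> \<Longrightarrow> \<phi>\<^sub>1 a + \<phi>\<^sub>2 b + hgt (\<rho> p) = 0"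
      by blast
    define R where "R a w \<longleftrightarrow> (\<exists>b p. killed (a, b) p \<and> \<rho> b \<le> n \<and> w = - \<phi>\<^sub>2 b - hgt (\<rho> p))" for a w
    define L where "L b w \<longleftrightarrow> (\<exists>a p. killed (a, b) p \<and> \<rho> a \<le> n \<and> w = - \<phi>\<^sub>1 a - hgt (\<rho> p))" for b w
    \<comment> \<open>\<open>SOME\<close> solves the equation that determines a new point, if there
      is one; otherwise the value is arbitrary.\<close>
    define \<psi>\<^sub>1 where "\<psi>\<^sub>1 a = (if \<rho> a \<le> n then \<phi>\<^sub>1 a else (SOME w. R a w))" for a
    define \<psi>\<^sub>2 where "\<psi>\<^sub>2 b = (if \<rho> b \<le> n then \<phi>\<^sub>2 b else (SOME w. L b w))" for b
    have "\<psi>\<^sub>1 a + \<psi>\<^sub>2 b + hgt (\<rho> p) = 0"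
      if k: "killed (a, b) p" and ra: "\<rho> a \<le> Suc n" and rb: "\<rho> b \<le> Suc n" for a b p
    proof -
      note K = killed_D[OF k]
      \<comment> \<open>A killed strand was already active when its later point, of rank
        \<open>Suc n\<close>, arrived. Hence two equations for one new point come from strands
        active at the same time and sharing that point in the same position, so they are the same
        equation.\<close>
      have act: "act (Suc n) (a', b')"
        if "killed (a', b') p'" "\<rho> a' \<le> Suc n" "\<rho> b' \<le> Suc n" "\<rho> a' = Suc n \<or> \<rho> b' = Suc n" for a' b' p'
        using killed_D[OF that(1)] that act_mono[of "\<rho> p' - 1" "(a', b')" "Suc n"] by auto
      consider "\<rho> a \<le> n" "\<rho> b \<le> n" | "\<rho> a = Suc n" "\<rho> b = Suc n" | "\<rho> a = Suc n" "\<rho> b \<le> n"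
        | "\<rho> a \<le> n" "\<rho> b = Suc n" using ra rb by linarith
      then show ?thesis
      proof cases
        case 1
        then show ?thesis using IH[OF k] by (simp add: \<psi>\<^sub>1_def \<psi>\<^sub>2_def)
      next
        case 2
        then show ?thesis using rank_inj[of a b] K by auto
      next
        case 3
        have "R a (SOME w. R a w)"
          by (rule someI[of _ "- \<phi>\<^sub>2 b - hgt (\<rho> p)"]) (use k 3 R_def in blast)
        then obtain b' p' where b': "killed (a, b') p'" "\<rho> b' \<le> n"
          "\<psi>\<^sub>1 a = - \<phi>\<^sub>2 b' - hgt (\<rho> p')" using 3 unfolding R_def[of a "Eps _"] by (auto simp: \<psi>\<^sub>1_def)
        have "b' = b" using act_same_fst[OF act[OF k] act[OF b'(1)]] b' 3 by auto
        then show ?thesis using b' killed_unique[OF k, of p'] 3 by (simp add: \<psi>\<^sub>2_def)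
      next
        case 4
        have "L b (SOME w. L b w)"
          by (rule someI[of _ "- \<phi>\<^sub>1 a - hgt (\<rho> p)"]) (use k 4 L_def in blast)
        then obtain a' p' where a': "killed (a', b) p'" "\<rho> a' \<le> n"
          "\<psi>\<^sub>2 b = - \<phi>\<^sub>1 a' - hgt (\<rho> p')" using 4 unfolding L_def[of b "Eps _"] by (auto simp: \<psi>\<^sub>2_def)
        have "a' = a" using act_same_snd[OF act[OF k] act[OF a'(1)]] a' 4 by auto
        then show ?thesis using a' killed_unique[OF k, of p'] 4 by (simp add: \<psi>\<^sub>1_def)
      qed
    qed
    then show ?case by blast
  qed
  from this[of "\<rho> Z"] show ?thesis
    using killed_D(2,3) rank_less_Z by (metis less_imp_le order_refl)
qed

end

locale leveled_sweep = sweep +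
  fixes \<phi>\<^sub>1 \<phi>\<^sub>2 :: "'a \<Rightarrow> real"
  assumes levels: "killed (a, b) p \<Longrightarrow> \<phi>\<^sub>1 a + \<phi>\<^sub>2 b + hgt (\<rho> p) = 0"
begin

text \<open>In the oblique coordinates used for the drawing, the abscissa of a strand at height \<open>h\<close>: strands
  whose second point is the later one move left, the others are vertical.\<close>

definition pos :: "'a \<times> 'a \<Rightarrow> real \<Rightarrow> real" where
  "pos s h = (if \<rho> (fst s) < \<rho> (snd s) then - \<phi>\<^sub>1 (fst s) - h else \<phi>\<^sub>2 (snd s))"

section \<open>Continuity at events and separation between them\<close>

lemma pos_killed: "killed (a, b) p \<Longrightarrow> pos (a, b) (hgt (\<rho> p)) = \<phi>\<^sub>2 b"
  using levels[of a b p] by (simp add: pos_def)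

text \<open>As \<open>pos\<close> is one formula for all heights, it is not automatic that a new
  strand starts where the killed one ends; this is the level equation of the vertex.\<close>

lemma pos_born_snd:
  assumes "killed (a, c) p"
  shows "pos (a, p) (hgt (\<rho> p)) = pos (a, c) (hgt (\<rho> p))"
  using pos_killed[OF assms] levels[OF assms] killed_D[OF assms] by (simp add: pos_def)

lemma pos_born_fst:
  assumes "killed (c, b) p"
  shows "pos (p, b) (hgt (\<rho> p)) = pos (c, b) (hgt (\<rho> p))"
  using pos_killed[OF assms] killed_D[OF assms] by (simp add: pos_def)

lemma predecessor:
  assumes "act (Suc t) s"
  obtains r where "act t r" "pos s (hgt (Suc t)) = pos r (hgt (Suc t))"
    "r = s \<or> (\<exists>p. \<rho> p = Suc t \<and> killed r p \<and> (s = (fst r, p) \<or> s = (p, snd r)))"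
proof -
  obtain a b where s: "s = (a, b)" by (cases s)
  note A = act_D[OF assms[unfolded s]]
  consider "\<rho> a \<le> t" "\<rho> b \<le> t" | "\<rho> b = Suc t" | "\<rho> a = Suc t" using A by linarith
  then show thesis
  proof cases
    case 1
    then show thesis using that[of s] act_mono[OF assms, of t] s by auto
  next
    case 2
    then obtain c where "killed (a, c) b" using act_born_snd[of b a] assms s by auto
    then show thesis using that[of "(a, c)"] pos_born_snd[of a c b] killed_D[of a c b] 2 s assms by auto
  next
    case 3
    then obtain c where "killed (c, b) a" using act_born_fst[of a b] assms s by auto
    then show thesis using that[of "(c, b)"] pos_born_fst[of c b a] killed_D[of c b a] 3 s assms by auto
  qed
qed

text \<open>Replacing one point of a killed strand by the new point preserves the order from left to
  right. A common predecessor splits into a left strand moving left and a vertical right strand,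
  which diverge.\<close>

lemma predecessor_le:
  assumes act: "act (Suc t) s" "act (Suc t) s'" and "le s s'" "s \<noteq> s'"
    and r: "act t r" "r = s \<or> (\<exists>p. \<rho> p = Suc t \<and> killed r p \<and> (s = (fst r, p) \<or> s = (p, snd r)))"
    and r': "act t r'"
      "r' = s' \<or> (\<exists>p. \<rho> p = Suc t \<and> killed r' p \<and> (s' = (fst r', p) \<or> s' = (p, snd r')))"
  shows "le r r' \<and> r \<noteq> r' \<or> r = r' \<and> \<rho> (fst s) < \<rho> (snd s) \<and> \<not> \<rho> (fst s') < \<rho> (snd s')"
proof -
  obtain a b a' b' where s: "s = (a, b)" "s' = (a', b')" by (cases s, cases s')
  obtain A B A' B' where R: "r = (A, B)" "r' = (A', B')" by (cases r, cases r')
  note D = act_D(5,6)[OF act(1)[unfolded s]] act_D(5,6)[OF act(2)[unfolded s]]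
    act_D(5,6)[OF r(1)[unfolded R]] act_D(5,6)[OF r'(1)[unfolded R]]
  have strong: "y b \<le> y a'" "x a' \<le> x b" using le_strong assms(1-4) s by metis+
  have new: "(a = A \<and> b = p \<or> a = p \<and> b = B)
      \<and> x p < x A \<and> y p < y B \<and> x B < x A \<and> y A < y B \<and> \<rho> A < \<rho> p \<and> \<rho> B < \<rho> p"
    if "killed r p" "s = (fst r, p) \<or> s = (p, snd r)" for p
    using killed_D[of A B p] that s R by auto
  have new': "(a' = A' \<and> b' = p \<or> a' = p \<and> b' = B')
      \<and> x p < x A' \<and> y p < y B' \<and> x B' < x A' \<and> y A' < y B' \<and> \<rho> A' < \<rho> p \<and> \<rho> B' < \<rho> p"
    if "killed r' p" "s' = (fst r', p) \<or> s' = (p, snd r')" for p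
    using killed_D[of A' B' p] that s R by auto
  have same: "p = p'" if "killed r p" "killed r' p'" "\<rho> p = Suc t" "\<rho> p' = Suc t" for p p'
    using rank_inj[of p p'] that by (auto simp: killed_def)
  show ?thesis
  proof (cases "r = r'")
    case True
    \<comment> \<open>One of the distinct \<open>s\<close> and \<open>s'\<close> differs from the
      common predecessor, which is therefore killed at \<open>Suc t\<close>; so neither of them is
      the predecessor itself.\<close>
    then obtain p where p: "\<rho> p = Suc t" "killed r p" "s = (fst r, p) \<or> s = (p, snd r)"
      using r(2) r'(2) assms(1-4) not_act_if_killed by (metis order_refl)
    then have "s' = (fst r, p) \<or> s' = (p, snd r)"
      using r'(2) True act not_act_if_killed same by (metis order_refl)
    then show ?thesis using new[OF p(2,3)] p s R True strong assms(4) D by fastforce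
  next
    case False
    have "le r r'"
    proof (rule ccontr)
      assume "\<not> le r r'"
      then have "le r' r" using le_total r r' by blast
      then have ss: "y B' \<le> y A" "x A \<le> x B'" using le_strong[of t A' B' A B] r r' R False by auto
      consider "r = s" "r' = s'"
        | p where "r = s" "killed r' p" "s' = (fst r', p) \<or> s' = (p, snd r')"
        | p where "killed r p" "s = (fst r, p) \<or> s = (p, snd r)" "r' = s'"
        | p where "killed r p" "s = (fst r, p) \<or> s = (p, snd r)"
            "killed r' p" "s' = (fst r', p) \<or> s' = (p, snd r')"
        using r(2) r'(2) same by metis
      then show False
      proof cases
        case 1
        then show False using \<open>\<not> le r r'\<close> assms by auto
      next
        case 2
        then show False using new'[OF 2(2,3)] s R ss strong D by auto
      next
        case 3
        then show False using new[OF 3(1,2)] s R ss strong D by auto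
      next
        case 4
        show False using new[OF 4(1,2)] new'[OF 4(3,4)] ss strong D by auto
      qed
    qed
    then show ?thesis using False by blast
  qed
qed

text \<open>The bound is the height of the slot just traversed, which makes it inductive: the next
  slot has half that height \<open>2 * d\<close> and the abscissae approach at most at unit speed,
  so a gap of \<open>2 * d\<close> keeps at least \<open>d\<close>, and a pair that has just split
  opens a gap of \<open>d\<close>.\<close>

lemma separation:
  assumes "act t s" "act t s'" "le s s'" "s \<noteq> s'"
  shows "pos s (hgt (Suc t)) + (1 / 2) ^ Suc t \<le> pos s' (hgt (Suc t))"
  using assms
proof (induction t arbitrary: s s')
  case 0
  have "r = (X, Y)" if "act 0 r" for r
    using act_D[of 0 "fst r" "snd r"] that rank_zero[of "fst r"] rank_zero[of "snd r"]
      strand_neq[of "fst r" "snd r"] by (cases r) auto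
  then show ?case using 0 by metis
next
  case (Suc t)
  define d where "d = (1 / 2 :: real) ^ Suc (Suc t)"
  have d: "(1 / 2 :: real) ^ Suc t = 2 * d" "0 < d" by (auto simp: d_def)
  have step: "pos r (hgt (Suc (Suc t))) =
      pos r (hgt (Suc t)) - (if \<rho> (fst r) < \<rho> (snd r) then d else 0)" for r
    unfolding hgt_Suc[of "Suc t"] d_def[symmetric] by (simp add: pos_def)
  obtain r where r: "act t r" "pos s (hgt (Suc t)) = pos r (hgt (Suc t))"
    "r = s \<or> (\<exists>p. \<rho> p = Suc t \<and> killed r p \<and> (s = (fst r, p) \<or> s = (p, snd r)))"
    using predecessor[OF Suc.prems(1)] by metis
  obtain r' where r': "act t r'" "pos s' (hgt (Suc t)) = pos r' (hgt (Suc t))"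
    "r' = s' \<or> (\<exists>p. \<rho> p = Suc t \<and> killed r' p \<and> (s' = (fst r', p) \<or> s' = (p, snd r')))"
    using predecessor[OF Suc.prems(2)] by metis
  from predecessor_le[OF Suc.prems r(1,3) r'(1,3)] show ?case
  proof (elim disjE conjE)
    assume "le r r'" "r \<noteq> r'"
    then have "pos r (hgt (Suc t)) + 2 * d \<le> pos r' (hgt (Suc t))"
      using Suc.IH[OF r(1) r'(1)] unfolding d(1) by simp
    then show ?thesis using step[of s] step[of s'] r(2) r'(2) d(2) unfolding d_def[symmetric] by (simp split: if_splits)
  next
    assume "r = r'" "\<rho> (fst s) < \<rho> (snd s)" "\<not> \<rho> (fst s') < \<rho> (snd s')"
    then show ?thesis using step[of s] step[of s'] r(2) r'(2) unfolding d_def[symmetric] by simp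
  qed
qed

text \<open>The last slot is unbounded: the strands \<open>(X, Z)\<close> and \<open>(Z, Y)\<close> run to infinity.\<close>

definition slot :: "nat \<Rightarrow> real \<Rightarrow> bool" where
  "slot t h \<longleftrightarrow> t \<le> \<rho> Z \<and> hgt t < h \<and> (h \<le> hgt (Suc t) \<or> t = \<rho> Z)"

section \<open>Strict order of the abscissae within a slot\<close>

lemma slot_exists:
  assumes "0 < h" obtains t where "slot t h"
proof -
  let ?T = "{t. t \<le> \<rho> Z \<and> hgt t < h}"
  have fin: "finite ?T" and "0 \<in> ?T" using assms by (auto simp: hgt_def)
  then have M: "Max ?T \<in> ?T" using Max_in by blast
  have "Suc (Max ?T) \<notin> ?T" using Max_ge[OF fin] by (metis Suc_n_not_le_n)
  then show thesis using that[of "Max ?T"] M by (auto simp: slot_def)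
qed

lemma slot_hgt: "slot t (hgt r) \<Longrightarrow> r \<le> \<rho> Z \<Longrightarrow> r = Suc t"
  by (auto simp: slot_def)

text \<open>\<open>Z\<close> has the smallest \<open>x\<close> and \<open>y\<close>, so it lies in
  every box and must be one of the two points; the other one then ties with it in a
  coordinate.\<close>

lemma act_last: assumes "act (\<rho> Z) s" shows "s = (X, Z) \<or> s = (Z, Y)"
proof -
  obtain a b where s: "s = (a, b)" by (cases s)
  note A = act_D[OF assms[unfolded s]]
  have "Z = a \<or> Z = b" using A(9)[of Z] mem x_Z_le y_Z_le A by auto
  then show ?thesis
  proof
    assume [simp]: "Z = a"
    have "x b = x a" using A x_Z_le[of b] by auto
    then show ?thesis using x_tie[of b a] A s by (auto simp: doubleton_eq_iff)
  next
    assume [simp]: "Z = b"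
    have "y b = y a" using A y_Z_le[of a] by auto
    then show ?thesis using y_tie[of b a] A s by (auto simp: doubleton_eq_iff)
  qed
qed

text \<open>\<open>separation\<close> gives a gap at the upper end of the slot; going down by less
  than \<open>(1 / 2) ^ Suc t\<close> closes less than that gap.\<close>

lemma pos_less:
  assumes "act t s" "act t s'" "le s s'" "s \<noteq> s'" "slot t h"
  shows "pos s h < pos s' h"
proof -
  have sep: "pos s (hgt (Suc t)) + (1 / 2) ^ Suc t \<le> pos s' (hgt (Suc t))"
    using separation assms by blast
  have h: "hgt (Suc t) - (1 / 2) ^ Suc t < h" using assms by (simp add: slot_def hgt_Suc)
  show ?thesis
  proof (cases "h \<le> hgt (Suc t)")
    case True
    then show ?thesis using sep h by (auto simp: pos_def split: if_splits)
  next
    case False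
    \<comment> \<open>Above the last slot's bound only \<open>(X, Z)\<close>, moving left, and the
      vertical \<open>(Z, Y)\<close> remain, and they diverge.\<close>
    then have [simp]: "t = \<rho> Z" using assms by (auto simp: slot_def)
    have "s = (X, Z) \<or> s = (Z, Y)" "s' = (X, Z) \<or> s' = (Z, Y)"
      using act_last assms by auto
    moreover have "\<not> le (Z, Y) (X, Z)" using x_less_X[of Z] mem Z_neq by (auto simp: le_def)
    ultimately have "s = (X, Z)" "s' = (Z, Y)" using assms by auto
    then have eq: "pos s k = - \<phi>\<^sub>1 X - k" "pos s' k = \<phi>\<^sub>2 Y" for k
      using Z_neq by (auto simp: pos_def)
    have "0 < (1 / 2 :: real) ^ Suc t" by simp
    then show ?thesis using sep False unfolding eq by linarith
  qed
qed

lemma pos_le_iff: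
  assumes "act t s" "act t s'" "slot t h" shows "pos s h \<le> pos s' h \<longleftrightarrow> le s s'"
  using pos_less[of t s s' h] pos_less[of t s' s h] le_total[of t s s'] le_antisym[of t s s'] assms
  by (metis less_le_not_le order_refl)

lemma pos_inj:
  assumes "act t s" "act t s'" "slot t h" "pos s h = pos s' h" shows "s = s'"
  using pos_le_iff[of t s s' h] pos_le_iff[of t s' s h] le_antisym assms by auto

text \<open>A further strand between two consecutive ones would have both of its points squeezed
  onto their shared step.\<close>

lemma pos_between:
  assumes act: "act t s" "act t s'" "act t r" and slot: "slot t h"
    and "pos s h \<le> pos r h" "pos r h \<le> pos s' h" and adj: "s = s' \<or> snd s = fst s'"
  shows "r = s \<or> r = s'"
proof (rule ccontr)
  assume n: "\<not> ?thesis"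
  obtain a b a' b' c d where e: "s = (a, b)" "s' = (a', b')" "r = (c, d)"
    by (cases s, cases s', cases r)
  have le: "le s r" "le r s'" using pos_le_iff assms by auto
  have "s \<noteq> s'" using le n le_antisym act by blast
  then have "b = a'" using adj e by auto
  moreover have "y b \<le> y c" "x c \<le> x b" "y d \<le> y a'" "x a' \<le> x d"
    using le_strong[of t a b c d] le_strong[of t c d a' b'] le n act e by auto
  ultimately show False using act_D[of t c d] act e xy_inj[of c d] by auto
qed

text \<open>The strand \<open>(X, Y)\<close> comes from infinity below.\<close>

definition alive :: "'a \<times> 'a \<Rightarrow> real \<Rightarrow> bool" where
  "alive s h \<longleftrightarrow> act (max (\<rho> (fst s)) (\<rho> (snd s))) s \<and>
     (s = (X, Y) \<or> hgt (max (\<rho> (fst s)) (\<rho> (snd s))) \<le> h) \<and> (\<forall>p. killed s p \<longrightarrow> h \<le> hgt (\<rho> p))"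

lemma alive_low: assumes "alive s h" "h \<le> 0" shows "s = (X, Y)"
proof (rule ccontr)
  assume "s \<noteq> (X, Y)"
  then have "hgt (max (\<rho> (fst s)) (\<rho> (snd s))) \<le> hgt 0"
    using assms by (auto simp: alive_def hgt_def[of 0])
  then have "\<rho> (fst s) = 0" "\<rho> (snd s) = 0" by auto
  then show False
    using assms act_D[of 0 "fst s" "snd s"] rank_zero strand_neq[of "fst s" "snd s"] \<open>s \<noteq> (X, Y)\<close>
    by (cases s) (auto simp: alive_def)
qed

text \<open>Slots contain their upper end, so at \<open>h = hgt (Suc t)\<close> a strand born at
  that event is alive too.\<close>

lemma alive_act:
  assumes "alive s h" "slot t h"
  shows "act t s \<or> act (Suc t) s \<and> h = hgt (Suc t)"
proof -
  obtain a b where s: "s = (a, b)" by (cases s)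
  define m where "m = max (\<rho> a) (\<rho> b)"
  have act: "act m (a, b)" and st: "s = (X, Y) \<or> hgt m \<le> h"
    and kill: "\<And>p. killed (a, b) p \<Longrightarrow> h \<le> hgt (\<rho> p)"
    using assms s by (auto simp: alive_def m_def)
  note A = act_D[OF act]
  have mZ: "m \<le> \<rho> Z" using A rank_less_Z unfolding m_def by (metis max.bounded_iff order_refl less_imp_le)
  show ?thesis
  proof (cases "hgt m < h \<or> s = (X, Y)")
    case True
    have "m \<le> t"
    proof (cases "s = (X, Y)")
      case False
      then have "hgt m < h" using True by auto
      then have "hgt m < hgt (Suc t) \<or> t = \<rho> Z" using assms(2) less_le_trans unfolding slot_def by blast
      then show ?thesis using mZ by auto
    qed (auto simp: m_def s)
    have "act t (a, b)"
    proof (rule act_I)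
      fix c assume c: "c \<in> P" "\<rho> c \<le> t" "x c \<le> x a" "y c \<le> y b"
      show "c = a \<or> c = b"
      proof (rule ccontr)
        assume "\<not> ?thesis"
        then obtain p where p: "killed (a, b) p" "\<rho> p \<le> \<rho> c" using act_dies[OF act, of c] c by metis
        then have "h \<le> hgt t" using kill[OF p(1)] c by (meson hgt_le_iff order_trans)
        then show False using assms(2) by (auto simp: slot_def)
      qed
    qed (use A \<open>m \<le> t\<close> in auto)
    then show ?thesis using s by simp
  next
    case False
    then have "h = hgt m" using st by auto
    then have "m = Suc t" using slot_hgt mZ assms by auto
    then show ?thesis using act s \<open>h = hgt m\<close> by auto
  qed
qed

text \<open>At height \<open>h\<close> in the time slot \<open>t\<close>, the edge \<open>E\<close> has a point with abscissa \<open>u\<close>: it either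
  is an active strand, or it touches the event at the end of the slot.\<close>

definition meets :: "nat \<Rightarrow> real \<Rightarrow> 'a set \<Rightarrow> real \<Rightarrow> bool" where
  "meets t h E u \<longleftrightarrow> slot t h \<and>
     ((\<exists>s. act t s \<and> E = {fst s, snd s} \<and> u = pos s h) \<or>
      (\<exists>s s' p. killed s p \<and> killed s' p \<and> \<rho> p = Suc t \<and> h = hgt (Suc t) \<and>
         E \<subseteq> {fst s, snd s, p} \<and> E \<subseteq> {fst s', snd s', p} \<and> pos s h \<le> u \<and> u \<le> pos s' h \<and>
         (s = s' \<or> snd s = fst s' \<and> E = {snd s, p})))"

section \<open>Edges through a vertex and common points of edges\<close>

lemma alive_meets:
  assumes "alive s h" "slot t h" shows "meets t h {fst s, snd s} (pos s h)"
proof (cases "act t s")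
  case True
  then show ?thesis using assms unfolding meets_def by blast
next
  case False
  then have a: "act (Suc t) s" and h: "h = hgt (Suc t)" using alive_act[OF assms] by auto
  obtain r where r: "act t r" "pos s h = pos r h"
    "r = s \<or> (\<exists>p. \<rho> p = Suc t \<and> killed r p \<and> (s = (fst r, p) \<or> s = (p, snd r)))"
    using predecessor[OF a] h by metis
  then obtain p where p: "\<rho> p = Suc t" "killed r p" "s = (fst r, p) \<or> s = (p, snd r)" using False by auto
  then have "{fst s, snd s} \<subseteq> {fst r, snd r, p}" by auto
  then show ?thesis using r(2) p(1,2) h assms(2) unfolding meets_def by (metis order_refl)
qed

lemma horizontal_meets:
  assumes k: "killed (c, q) p" "killed (q, d) p"
    and u: "pos (c, q) (hgt (\<rho> p)) \<le> u" "u \<le> pos (q, d) (hgt (\<rho> p))" and "slot t (hgt (\<rho> p))"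
  shows "meets t (hgt (\<rho> p)) {q, p} u"
proof -
  have "\<rho> p \<le> \<rho> Z" using rank_less_Z killed_D(4)[OF k(1)] by (metis less_imp_le order_refl)
  then have "\<rho> p = Suc t" using slot_hgt assms by auto
  then show ?thesis using assms unfolding meets_def
    by (intro conjI disjI2 exI[of _ "(c, q)"] exI[of _ "(q, d)"] exI[of _ p]) auto
qed

lemma meets_vertex:
  assumes m: "meets t h E (pos s\<^sub>0 h)" and k: "killed s\<^sub>0 p\<^sub>0" and h: "h = hgt (\<rho> p\<^sub>0)"
  shows "E \<subseteq> {fst s\<^sub>0, snd s\<^sub>0, p\<^sub>0}"
proof -
  have slot: "slot t h" using m by (auto simp: meets_def)
  have p0: "p\<^sub>0 \<in> P" using k by (auto simp: killed_def)
  then have "\<rho> p\<^sub>0 \<le> \<rho> Z" using rank_less_Z by (metis less_imp_le order_refl)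
  then have r0: "\<rho> p\<^sub>0 = Suc t" using slot_hgt slot h by auto
  then have a0: "act t s\<^sub>0" using k by (auto simp: killed_def)
  from m consider s where "act t s" "E = {fst s, snd s}" "pos s\<^sub>0 h = pos s h"
    | s s' p where "killed s p" "killed s' p" "\<rho> p = Suc t" "E \<subseteq> {fst s, snd s, p}"
      "E \<subseteq> {fst s', snd s', p}" "pos s h \<le> pos s\<^sub>0 h" "pos s\<^sub>0 h \<le> pos s' h"
      "s = s' \<or> snd s = fst s' \<and> E = {snd s, p}" unfolding meets_def by blast
  then show ?thesis
  proof cases
    case 1
    then show ?thesis using pos_inj[OF a0 _ slot] by auto
  next
    case (2 s s' p)
    have "p = p\<^sub>0" using rank_inj[of p p\<^sub>0] 2 p0 r0 by (auto simp: killed_def)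
    moreover have "s\<^sub>0 = s \<or> s\<^sub>0 = s'"
      using pos_between[of t s s' s\<^sub>0 h] 2 a0 slot by (auto simp: killed_def)
    ultimately show ?thesis using 2 by auto
  qed
qed

text \<open>Two strands with one abscissa coincide; a strand that meets a horizontal edge is one of
  the two killed strands bounding it, by \<open>pos_between\<close>; two horizontal edges of one
  event lie between consecutive killed strands and share at most an end. So the common point is the
  end of a killed strand.\<close>

lemma meets_common:
  assumes "meets t h E u" "meets t h E' u" "E \<noteq> E'"
  obtains s p where "killed s p" "h = hgt (\<rho> p)" "u = pos s h"
proof -
  have slot: "slot t h" using assms by (auto simp: meets_def)
  note vertex = that
  let ?A = "\<lambda>E. \<exists>s. act t s \<and> E = {fst s, snd s} \<and> u = pos s h"
  define B where "B E s s' p \<longleftrightarrow> killed s p \<and> killed s' p \<and> \<rho> p = Suc t \<and> h = hgt (\<rho> p) \<and>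
      pos s h \<le> u \<and> u \<le> pos s' h \<and> (s = s' \<or> snd s = fst s' \<and> E = {snd s, p})" for E s s' p
  have cases: "?A E \<or> (\<exists>s s' p. B E s s' p)" "?A E' \<or> (\<exists>s s' p. B E' s s' p)"
    using assms unfolding meets_def B_def by metis+
  have act: "act t s" "act t s'" if "B E s s' p" for E s s' p
    using that by (auto simp: B_def killed_def)
  have mixed: thesis if A: "act t r" "u = pos r h" and "B E s s' p" for r E s s' p
  proof -
    have "r = s \<or> r = s'"
      using pos_between[of t s s' r h] act[of E s s' p] that slot by (auto simp: B_def)
    then show thesis using that vertex[of s p] vertex[of s' p] by (auto simp: B_def)
  qed
  have two: thesis
    if b: "B E s s' p" "B E' r r' p'" and le: "pos s h \<le> pos r h" and "E \<noteq> E'" for E E' s s' r r' p p'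
  proof -
    have "p = p'" using b rank_inj unfolding B_def killed_def by (metis zero_less_Suc)
    have B: "pos s h \<le> u" "u \<le> pos s' h" "s = s' \<or> snd s = fst s' \<and> E = {snd s, p}"
      "pos r h \<le> u" "u \<le> pos r' h" "r = r' \<or> snd r = fst r' \<and> E' = {snd r, p}"
      "killed s p" "killed s' p" "killed r p" "h = hgt (\<rho> p)"
      using b \<open>p = p'\<close> unfolding B_def by blast+
    have "r = s \<or> r = s'"
      using pos_between[OF act(1)[OF b(1)] act(2)[OF b(1)] act(1)[OF b(2)] slot le]
        order_trans[OF B(4,2)] B(3) by blast
    then consider "r = s'" | "s = s'" | "r = r'" | "r = s" "E = E'"
      using B by auto
    then show thesis
    proof cases
      case 1
      then show thesis using vertex[OF B(8,10)] B by auto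
    next
      case 2
      then show thesis using vertex[OF B(7,10)] B by auto
    next
      case 3
      then show thesis using vertex[OF B(9,10)] B by auto
    next
      case 4
      then show thesis using \<open>E \<noteq> E'\<close> by blast
    qed
  qed
  from cases consider "?A E" "?A E'" | s s' p where "?A E" "B E' s s' p"
    | s s' p where "?A E'" "B E s s' p" | s s' p r r' p' where "B E s s' p" "B E' r r' p'"
    by blast
  then show thesis
  proof cases
    case 1
    then show thesis using pos_inj slot assms(3) by metis
  next
    case 2
    then show thesis using mixed by blast
  next
    case 3
    then show thesis using mixed by blast
  next
    case 4
    then show thesis using two assms(3) by (metis linear)
  qed
qed

end

section \<open>The position of an edge in a vertex\<close>

context sweep
begin

text \<open>The three cases are the possible ends: the vertex where the strand is killed and the one
  where its second or its first point arrives. Any other placement reverses the strand.\<close>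

lemma strand_in_vertex:
  assumes "strand a b" "killed (a', b') p" "a \<in> {a', b', p}" "b \<in> {a', b', p}"
  shows "a' = a \<and> b' = b \<or> a' = a \<and> p = b \<or> p = a \<and> b' = b"
  using assms killed_D[OF assms(2)] strand_antisym[of a b] by (auto simp: strand_def)

lemma horizontal_in_vertex:
  assumes "x p < x q" "y p < y q" "killed (a', b') p'" "q \<in> {a', b', p'}" "p \<in> {a', b', p'}"
  shows "p' = p \<and> (b' = q \<or> a' = q)"
  using assms killed_D[OF assms(3)] by auto

text \<open>The roles of the three points can be read off the unordered set, which makes
  \<open>drawn\<close> well defined.\<close>

lemma killed_vertex_inj:
  assumes "killed (a, b) p" "killed (a', b') p'" "{a, b, p} = {a', b', p'}"
  shows "a = a' \<and> b = b' \<and> p = p'"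
proof -
  note K = killed_D[OF assms(1)] killed_D[OF assms(2)]
  have "a' = a \<and> b' = b \<or> a' = a \<and> p' = b \<or> p' = a \<and> b' = b"
    using strand_in_vertex[OF K(15) assms(2)] assms(3) by blast
  moreover have "p \<in> {a', b', p'}" using assms(3) by blast
  ultimately show ?thesis using K by (elim disjE) auto
qed

end

subsection \<open>The combinatorics of the complex\<close>

lemma exists_3: "(\<exists>i::3. Q i) \<longleftrightarrow> Q 1 \<or> Q 2 \<or> Q 3"
  by (metis exhaust_3)

locale generic_set =
  fixes S :: "(real ^ 3) set" and X Y Z :: "real ^ 3"
  assumes finite_S: "finite S"
    and nonneg: "p \<in> S \<Longrightarrow> 0 \<le> p $ i"
    and XYZ_in: "X \<in> S" "Y \<in> S" "Z \<in> S"
    and X_coords: "0 < X $ 1" "X $ 2 = 0" "X $ 3 = 0"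
    and Y_coords: "Y $ 1 = 0" "0 < Y $ 2" "Y $ 3 = 0"
    and Z_coords: "Z $ 1 = 0" "Z $ 2 = 0" "0 < Z $ 3"
    and plane_1: "\<lbrakk>p \<in> S; p $ 1 = 0\<rbrakk> \<Longrightarrow> p = Y \<or> p = Z"
    and plane_2: "\<lbrakk>p \<in> S; p $ 2 = 0\<rbrakk> \<Longrightarrow> p = X \<or> p = Z"
    and plane_3: "\<lbrakk>p \<in> S; p $ 3 = 0\<rbrakk> \<Longrightarrow> p = X \<or> p = Y"
    and generic: "\<lbrakk>p \<in> S; q \<in> S; p $ i = q $ i; p $ i \<noteq> 0\<rbrakk> \<Longrightarrow> p = q"
begin

lemma vrm_iff: "p \<in> vrm S \<longleftrightarrow> p \<in> S \<and> (\<forall>q\<in>S. (\<forall>i. q $ i \<le> p $ i) \<longrightarrow> q = p)"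
  using nonneg by (auto simp: vrm_def Pi_box_def extent_def disjoint_iff)

lemma vrm_S: "p \<in> vrm S \<Longrightarrow> p \<in> S"
  by (simp add: vrm_def)

lemma XYZ_vrm: "X \<in> vrm S" "Y \<in> vrm S" "Z \<in> vrm S"
proof -
  have "q = X" if "q \<in> S" "q $ 2 \<le> X $ 2" "q $ 3 \<le> X $ 3" for q
    using that plane_2[of q] plane_3[of q] nonneg[of q 2] nonneg[of q 3] X_coords Z_coords Y_coords by force
  moreover have "q = Y" if "q \<in> S" "q $ 1 \<le> Y $ 1" "q $ 3 \<le> Y $ 3" for q
    using that plane_1[of q] plane_3[of q] nonneg[of q 1] nonneg[of q 3] X_coords Z_coords Y_coords by force
  moreover have "q = Z" if "q \<in> S" "q $ 1 \<le> Z $ 1" "q $ 2 \<le> Z $ 2" for q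
    using that plane_1[of q] plane_2[of q] nonneg[of q 1] nonneg[of q 2] X_coords Z_coords Y_coords by force
  ultimately show "X \<in> vrm S" "Y \<in> vrm S" "Z \<in> vrm S"
    using XYZ_in by (auto simp: vrm_iff forall_3)
qed

text \<open>Counting strictly lower points gives \<open>X\<close> and \<open>Y\<close> the common
  rank 0 and turns heights into integer event times.\<close>

definition zrank :: "real ^ 3 \<Rightarrow> nat" where
  "zrank p = card {q \<in> vrm S. q $ 3 < p $ 3}"

lemma finite_vrm: "finite (vrm S)"
  using finite_S by (rule finite_subset[rotated]) (auto simp: vrm_def)

lemma zrank_less_iff: assumes "p \<in> vrm S" "q \<in> vrm S" shows "zrank p < zrank q \<longleftrightarrow> p $ 3 < q $ 3"
proof
  assume "p $ 3 < q $ 3"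
  then have "{r \<in> vrm S. r $ 3 < p $ 3} \<subset> {r \<in> vrm S. r $ 3 < q $ 3}"
    using assms by auto
  then show "zrank p < zrank q"
    unfolding zrank_def using finite_vrm by (intro psubset_card_mono) auto
next
  assume r: "zrank p < zrank q"
  show "p $ 3 < q $ 3"
  proof (rule ccontr)
    assume "\<not> ?thesis"
    then have "{r \<in> vrm S. r $ 3 < q $ 3} \<subseteq> {r \<in> vrm S. r $ 3 < p $ 3}" by auto
    then have "zrank q \<le> zrank p" unfolding zrank_def using finite_vrm by (intro card_mono) auto
    then show False using r by simp
  qed
qed

lemma zrank_le_iff: "\<lbrakk>p \<in> vrm S; q \<in> vrm S\<rbrakk> \<Longrightarrow> zrank p \<le> zrank q \<longleftrightarrow> p $ 3 \<le> q $ 3"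
  using zrank_less_iff[of q p] by (simp add: linorder_not_less[symmetric])

sublocale sweep "vrm S" "\<lambda>p. p $ 1" "\<lambda>p. p $ 2" zrank X Y Z
proof
  show "finite (vrm S)" "X \<in> vrm S" "Y \<in> vrm S" "Z \<in> vrm S"
    using finite_vrm XYZ_vrm by auto
  show "X \<noteq> Y" "Y $ 1 = Z $ 1" "X $ 2 = Z $ 2" using X_coords Y_coords Z_coords by auto
  fix a assume a: "a \<in> vrm S"
  then have "a \<in> S" by (rule vrm_S)
  \<comment> \<open>The other coordinates of \<open>X\<close> vanish, so a point with at least its
    \<open>x\<close>-coordinate would have \<open>X\<close> in its box.\<close>
  show "a $ 1 < X $ 1" if "a \<noteq> X"
    using a nonneg[OF \<open>a \<in> S\<close>] that XYZ_in X_coords unfolding vrm_iff forall_3 by force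
  show "a $ 2 < Y $ 2" if "a \<noteq> Y"
    using a nonneg[OF \<open>a \<in> S\<close>] that XYZ_in Y_coords unfolding vrm_iff forall_3 by force
  show "Z $ 1 \<le> a $ 1" "Z $ 2 \<le> a $ 2" using nonneg \<open>a \<in> S\<close> Z_coords by auto
  have "a $ 3 < Z $ 3" if "a \<noteq> Z"
    using a nonneg[OF \<open>a \<in> S\<close>] that XYZ_in Z_coords unfolding vrm_iff forall_3 by force
  then show "zrank a < zrank Z" if "a \<noteq> Z" using that zrank_less_iff a XYZ_vrm by auto
  fix b assume b: "b \<in> vrm S"
  then have "b \<in> S" by (rule vrm_S)
  show "a = b \<or> {a, b} = {Y, Z}" if "a $ 1 = b $ 1"
    using that generic[of a b 1] plane_1[of a] plane_1[of b] \<open>a \<in> S\<close> \<open>b \<in> S\<close> by (cases "a $ 1 = 0") auto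
  show "a = b \<or> {a, b} = {X, Z}" if "a $ 2 = b $ 2"
    using that generic[of a b 2] plane_2[of a] plane_2[of b] \<open>a \<in> S\<close> \<open>b \<in> S\<close> by (cases "a $ 2 = 0") auto
  show "a = b \<or> {a, b} = {X, Y}" if "zrank a = zrank b"
  proof -
    have "a $ 3 = b $ 3" using that zrank_le_iff[of a b] zrank_le_iff[of b a] a b by auto
    then show ?thesis
      using generic[of a b 3] plane_3[of a] plane_3[of b] \<open>a \<in> S\<close> \<open>b \<in> S\<close> by (cases "a $ 3 = 0") auto
  qed
  show "a = b" if "a $ 1 \<le> b $ 1" "a $ 2 \<le> b $ 2" "zrank a \<le> zrank b"
    using that zrank_le_iff[OF a b] b \<open>a \<in> S\<close> unfolding vrm_iff forall_3 by blast
next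
  have "{q \<in> vrm S. q $ 3 < 0} = {}" using nonneg[of _ 3] vrm_S by force
  then show "zrank X = 0" "zrank Y = 0"
    unfolding zrank_def X_coords Y_coords by (simp_all only: card.empty)
qed

section \<open>Edges as strands or horizontal pairs, vertices as killed triples\<close>

lemma le_extent_iff: "\<lbrakk>finite F; F \<noteq> {}\<rbrakk> \<Longrightarrow> c \<le> extent F i \<longleftrightarrow> (\<exists>d\<in>F. c \<le> d $ i)"
  by (auto simp: extent_def Max_ge_iff)

lemma minimal_set_iff:
  assumes "finite F" "F \<noteq> {}" "F \<subseteq> vrm S"
  shows "minimal_set S F \<longleftrightarrow> (\<forall>c\<in>vrm S. (\<forall>i. \<exists>d\<in>F. c $ i \<le> d $ i) \<longrightarrow> c \<in> F)"
  using assms nonneg vrm_S by (auto simp: minimal_set_def Pi_box_def le_extent_iff disjoint_iff)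

lemma minimal_pair_iff:
  assumes "a \<in> vrm S" "b \<in> vrm S" "a \<noteq> b"
  shows "{a, b} \<in> MV_edges S \<longleftrightarrow>
    (\<forall>c\<in>vrm S. (\<forall>i. c $ i \<le> a $ i \<or> c $ i \<le> b $ i) \<longrightarrow> c = a \<or> c = b)"
  using assms minimal_set_iff[of "{a, b}"] by (simp add: MV_edges_def minimal_sets_def)

text \<open>A pair incomparable in the projection spans a corner that is empty up to the later rank,
  hence an active strand. In a comparable pair the lower point \<open>p\<close> has the larger
  \<open>z\<close>, so the box has the base of \<open>q\<close> and the height of
  \<open>p\<close>.\<close>

lemma edge_cases:
  assumes "E \<in> MV_edges S"
  obtains a b where "E = {a, b}" "act (max (zrank a) (zrank b)) (a, b)"
  | q p where "E = {q, p}" "p \<in> vrm S" "q \<in> vrm S" "p $ 1 < q $ 1" "p $ 2 < q $ 2"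
      "\<And>c. \<lbrakk>c \<in> vrm S; zrank c \<le> zrank p; c $ 1 \<le> q $ 1; c $ 2 \<le> q $ 2\<rbrakk> \<Longrightarrow> c = p \<or> c = q"
proof -
  note goal = that
  obtain a b where E: "E = {a, b}" "a \<noteq> b" and ab: "a \<in> vrm S" "b \<in> vrm S"
    using assms by (auto simp: MV_edges_def minimal_sets_def minimal_set_def card_2_iff)
  have box: "c = a \<or> c = b"
    if "c \<in> vrm S" "c $ 1 \<le> a $ 1 \<or> c $ 1 \<le> b $ 1" "c $ 2 \<le> a $ 2 \<or> c $ 2 \<le> b $ 2"
      "c $ 3 \<le> a $ 3 \<or> c $ 3 \<le> b $ 3" for c
    using minimal_pair_iff[OF ab E(2)] assms E that by (auto simp: forall_3)
  have str: "act (max (zrank v) (zrank w)) (v, w)" if "{v, w} = {a, b}" "w $ 1 \<le> v $ 1" "v $ 2 \<le> w $ 2" for v w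
  proof (rule act_I)
    have vw: "v \<in> vrm S" "w \<in> vrm S" using that(1) ab by (auto simp: doubleton_eq_iff)
    then show "strand v w" using that E(2) by (auto simp: strand_def)
    fix c assume c: "c \<in> vrm S" "zrank c \<le> max (zrank v) (zrank w)" "c $ 1 \<le> v $ 1" "c $ 2 \<le> w $ 2"
    then have "c $ 3 \<le> v $ 3 \<or> c $ 3 \<le> w $ 3" using zrank_le_iff vw by (auto simp: le_max_iff_disj)
    then show "c = v \<or> c = w" using box[of c] c that(1) by (auto simp: doubleton_eq_iff)
  qed auto
  have hor: thesis if vw: "{v, w} = {a, b}" "w $ 1 < v $ 1" "w $ 2 < v $ 2" for v w
  proof (rule goal(2)[of v w])
    show "E = {v, w}" "w \<in> vrm S" "v \<in> vrm S" using vw(1) ab E by (auto simp: doubleton_eq_iff)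
    fix c assume c: "c \<in> vrm S" "zrank c \<le> zrank w" "c $ 1 \<le> v $ 1" "c $ 2 \<le> v $ 2"
    then have "c $ 3 \<le> w $ 3" using zrank_le_iff \<open>w \<in> vrm S\<close> by auto
    then show "c = w \<or> c = v" using box[of c] c vw(1) by (auto simp: doubleton_eq_iff)
  qed (use vw in auto)
  consider "b $ 1 \<le> a $ 1" "a $ 2 \<le> b $ 2" | "a $ 1 \<le> b $ 1" "b $ 2 \<le> a $ 2"
    | "b $ 1 < a $ 1" "b $ 2 < a $ 2" | "a $ 1 < b $ 1" "a $ 2 < b $ 2" by linarith
  then show thesis
  proof cases
    case 1
    then show thesis using goal(1)[OF E(1)] str by blast
  next
    case 2
    then show thesis using goal(1)[of b a] str[of b a] E(1) by (simp add: insert_commute)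
  next
    case 3
    then show thesis using hor by blast
  next
    case 4
    then show thesis using hor[of b a] by (simp add: insert_commute)
  qed
qed

text \<open>As all pairs are edges, no point lies in the box of the other two, so each is the strict
  maximum in some coordinate. Three points share out three coordinates, which fixes the roles
  \<open>a\<close>, \<open>b\<close>, \<open>p\<close>.\<close>

lemma vertex_iff: "V \<in> MV_vertices S \<longleftrightarrow> (\<exists>a b p. V = {a, b, p} \<and> killed (a, b) p)"
proof
  assume V: "V \<in> MV_vertices S"
  then obtain u v w where V_eq: "V = {u, v, w}" "u \<noteq> v" "u \<noteq> w" "v \<noteq> w"
    by (auto simp: MV_vertices_def minimal_sets_def card_3_iff)
  have min: "minimal_set S V" and sub: "V \<subseteq> vrm S"
    using V by (auto simp: MV_vertices_def minimal_sets_def minimal_set_def)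
  have edge: "\<exists>i. c $ i > a $ i \<and> c $ i > b $ i" if "{a, b, c} = V" "a \<noteq> b" "c \<noteq> a" "c \<noteq> b" for a b c
  proof -
    have "{a, b} \<in> MV_edges S" using V that by (auto simp: MV_vertices_def)
    moreover have "a \<in> vrm S" "b \<in> vrm S" "c \<in> vrm S" using that(1) sub by auto
    ultimately have "\<not> (\<forall>i. c $ i \<le> a $ i \<or> c $ i \<le> b $ i)"
      using minimal_pair_iff[of a b] that by blast
    then show ?thesis by (auto simp: not_le)
  qed
  have "\<exists>i. u $ i > v $ i \<and> u $ i > w $ i" "\<exists>i. v $ i > u $ i \<and> v $ i > w $ i"
    "\<exists>i. w $ i > u $ i \<and> w $ i > v $ i"
    by (rule edge; use V_eq in auto)+
  moreover define roles where "roles a b p \<longleftrightarrow> a $ 1 > b $ 1 \<and> a $ 1 > p $ 1 \<and>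
      b $ 2 > a $ 2 \<and> b $ 2 > p $ 2 \<and> p $ 3 > a $ 3 \<and> p $ 3 > b $ 3" for a b p :: "real ^ 3"
  ultimately have "roles u v w \<or> roles u w v \<or> roles v u w \<or> roles v w u \<or> roles w u v \<or> roles w v u"
    unfolding exists_3 by (elim disjE conjE) simp_all
  then have "\<exists>a b p. V = {a, b, p} \<and> roles a b p"
    unfolding V_eq(1) by (metis insert_commute)
  then obtain a b p where abp: "V = {a, b, p}" "a $ 1 > b $ 1" "a $ 1 > p $ 1" "b $ 2 > a $ 2"
    "b $ 2 > p $ 2" "p $ 3 > a $ 3" "p $ 3 > b $ 3" unfolding roles_def by blast
  have mem: "a \<in> vrm S" "b \<in> vrm S" "p \<in> vrm S" using abp sub by auto
  then have r: "zrank a < zrank p" "zrank b < zrank p" using abp zrank_less_iff by auto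
  have "act (zrank p - 1) (a, b)"
  proof (rule act_I)
    show "strand a b" using abp mem by (auto simp: strand_def)
    fix c assume c: "c \<in> vrm S" "zrank c \<le> zrank p - 1" "c $ 1 \<le> a $ 1" "c $ 2 \<le> b $ 2"
    then have "zrank c < zrank p" using r by auto
    then have "c $ 3 < p $ 3" using zrank_less_iff c mem by auto
    then have "c \<in> V" using minimal_set_iff[of V] min sub c abp(1) by (auto simp: forall_3)
    then show "c = a \<or> c = b" using abp \<open>zrank c < zrank p\<close> by auto
  qed (use r in auto)
  then have "killed (a, b) p" using mem abp r by (auto simp: killed_def)
  then show "\<exists>a b p. V = {a, b, p} \<and> killed (a, b) p" using abp by blast
next
  assume "\<exists>a b p. V = {a, b, p} \<and> killed (a, b) p"
  then obtain a b p where V: "V = {a, b, p}" and k: "killed (a, b) p" by blast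
  note K = killed_D[OF k]
  have box: "c \<in> {a, b, p}" if "c \<in> vrm S" "c $ 1 \<le> a $ 1" "c $ 2 \<le> b $ 2" "c $ 3 \<le> p $ 3" for c
  proof (cases "zrank c = zrank p")
    case True
    have "p = c" by (rule rank_inj) (use True that(1) K(4,5) in simp_all)
    then show ?thesis by blast
  next
    case False
    then have "zrank c \<le> zrank p - 1" using zrank_le_iff[of c p] that(1,4) K(4) by simp
    then show ?thesis using act_D(9)[OF K(1), of c] that by blast
  qed
  have z: "a $ 3 < p $ 3" "b $ 3 < p $ 3"
    using K(2-4,9,10) zrank_less_iff[of a p] zrank_less_iff[of b p] by auto
  have "c \<in> V" if "c \<in> vrm S" "\<forall>i. \<exists>d\<in>V. c $ i \<le> d $ i" for c
    using box[OF that(1)] that(2) K(11-14) z unfolding V forall_3 by force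
  then have "minimal_set S V"
    using minimal_set_iff[of V] K(2-4) V by auto
  moreover have "card V = 3" using V K(6-8) by auto
  moreover have "{a, b} \<in> MV_edges S"
    unfolding minimal_pair_iff[OF K(2,3,6)] using box K(11-14) z unfolding forall_3 by force
  moreover have "{a, p} \<in> MV_edges S"
    unfolding minimal_pair_iff[OF K(2,4,7)] using box K(11-14) z unfolding forall_3 by force
  moreover have "{b, p} \<in> MV_edges S"
    unfolding minimal_pair_iff[OF K(3,4,8)] using box K(11-14) z unfolding forall_3 by force
  moreover have "E = {a, b} \<or> E = {a, p} \<or> E = {b, p}" if "E \<subseteq> V" "card E = 2" for E
    using that unfolding V card_2_iff by auto
  ultimately show "V \<in> MV_vertices S" unfolding MV_vertices_def minimal_sets_def by blast
qed

lemma extent_vertex: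
  assumes "killed (a, b) p"
  shows "extent {a, b, p} 1 = a $ 1" "extent {a, b, p} 2 = b $ 2" "extent {a, b, p} 3 = p $ 3"
  using killed_D[OF assms] zrank_less_iff[of a p] zrank_less_iff[of b p] by (auto simp: extent_def max_def)

end

subsection \<open>The drawing\<close>

text \<open>In this basis \<open>e1\<close>, \<open>e2\<close>, \<open>e3\<close> become
  \<open>(-1, 1)\<close>, \<open>(0, 1)\<close>, \<open>(1, 0)\<close>, so both strand directions
  rise by one unit of \<open>h\<close>.\<close>

definition plane :: "real \<Rightarrow> real \<Rightarrow> real ^ 2" where
  "plane u h = u *\<^sub>R e3 + h *\<^sub>R e2"

lemma e1_eq: "e1 = e2 - e3"
  by (simp add: e1_def e2_def e3_def vec_eq_iff forall_2)

lemma plane_eq_iff: "plane u h = plane u' h' \<longleftrightarrow> u = u' \<and> h = h'"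
  by (auto simp: plane_def e2_def e3_def vec_eq_iff forall_2)

lemma e_neq_0: "e1 \<noteq> 0" "e2 \<noteq> 0" "- e2 \<noteq> 0"
  by (auto simp: e1_def e2_def vec_eq_iff forall_2)

text \<open>\<open>drawable\<close> treats a finite edge in one orientation; this yields the other.
  The six exchanges exclude each other, so the order of the tests in \<open>label\<close> is
  immaterial.\<close>

lemma label_swap: "label V' V = - label V V'"
proof -
  have swap: "exchange i j V' V \<longleftrightarrow> exchange j i V V'" for i j
    by (auto simp: exchange_def)
  have excl: "\<not> (exchange i j V V' \<and> exchange i' j' V V')" if "i \<noteq> i' \<or> j \<noteq> j'" for i j i' j'
    using that unfolding exchange_def by (metis less_irrefl order_less_asym)
  show ?thesis
    unfolding label_def swap
    using excl[of 3 2 2 3] excl[of 3 1 1 3] excl[of 2 1 1 2] by auto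
qed

locale leveled_set = generic_set +
  fixes \<phi>\<^sub>1 \<phi>\<^sub>2 :: "real ^ 3 \<Rightarrow> real"
  assumes set_levels: "killed (a, b) p \<Longrightarrow> \<phi>\<^sub>1 a + \<phi>\<^sub>2 b + hgt (zrank p) = 0"
begin

sublocale leveled_sweep "vrm S" "\<lambda>p. p $ 1" "\<lambda>p. p $ 2" zrank X Y Z \<phi>\<^sub>1 \<phi>\<^sub>2
  by unfold_locales (rule set_levels)

definition drawn :: "(real ^ 3) set \<Rightarrow> real ^ 2" where
  "drawn V = (SOME w. \<exists>a b p. V = {a, b, p} \<and> killed (a, b) p \<and> w = plane (\<phi>\<^sub>2 b) (hgt (zrank p)))"

lemma drawn_eq: assumes "killed (a, b) p" shows "drawn {a, b, p} = plane (\<phi>\<^sub>2 b) (hgt (zrank p))"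
  unfolding drawn_def
proof (rule someI2)
  show "\<exists>a' b' p'. {a, b, p} = {a', b', p'} \<and> killed (a', b') p' \<and>
      plane (\<phi>\<^sub>2 b) (hgt (zrank p)) = plane (\<phi>\<^sub>2 b') (hgt (zrank p'))" using assms by blast
next
  fix w assume "\<exists>a' b' p'. {a, b, p} = {a', b', p'} \<and> killed (a', b') p' \<and>
      w = plane (\<phi>\<^sub>2 b') (hgt (zrank p'))"
  then show "w = plane (\<phi>\<^sub>2 b) (hgt (zrank p))" using killed_vertex_inj[OF assms] by metis
qed

lemma drawn_killed:
  "killed (a, b) p \<Longrightarrow> drawn {a, b, p} = plane (pos (a, b) (hgt (zrank p))) (hgt (zrank p))"
  using drawn_eq pos_killed by simp

lemma ends_iff: "V \<in> ends S E \<longleftrightarrow> E \<subseteq> V \<and> (\<exists>a b p. V = {a, b, p} \<and> killed (a, b) p)"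
  unfolding ends_def vertex_iff by blast

text \<open>Heights \<open>h \<le> 0\<close> lie below all events; only the edge \<open>{X, Y}\<close> extends there.\<close>

definition covers :: "(real ^ 3) set \<Rightarrow> real ^ 2 \<Rightarrow> bool" where
  "covers E w \<longleftrightarrow> (\<exists>u h. w = plane u h \<and>
     (h \<le> 0 \<and> E = {X, Y} \<or> 0 < h \<and> (\<forall>t. slot t h \<longrightarrow> meets t h E u)))"

lemma covers_alive: assumes "alive (a, b) h" shows "covers {a, b} (plane (pos (a, b) h) h)"
proof (cases "h \<le> 0")
  case True
  then show ?thesis using alive_low[OF assms] unfolding covers_def by auto
next
  case False
  then show ?thesis using alive_meets[OF assms] unfolding covers_def by (metis fst_conv snd_conv not_le)
qed

text \<open>From the lower to the upper end, \<open>b\<close> passes from realising the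
  \<open>z\<close>-size to realising the \<open>y\<close>-size, while \<open>a\<close> keeps the
  \<open>x\<close>-size.\<close>

lemma label_left: "\<lbrakk>killed (a, c) b; killed (a, b) p\<rbrakk> \<Longrightarrow> label {a, c, b} {a, b, p} = e1"
  using killed_D[of a c b] killed_D[of a b p] zrank_less_iff[of b p]
  by (simp add: label_def exchange_def forall_3 extent_vertex)

lemma label_right: "\<lbrakk>killed (c, b) a; killed (a, b) p\<rbrakk> \<Longrightarrow> label {c, b, a} {a, b, p} = e2"
  using killed_D[of c b a] killed_D[of a b p] zrank_less_iff[of a p]
  by (simp add: label_def exchange_def forall_3 extent_vertex)

lemma label_horizontal: "\<lbrakk>killed (c, q) p; killed (q, d) p\<rbrakk> \<Longrightarrow> label {c, q, p} {q, d, p} = e3"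
  using killed_D[of c q p] killed_D[of q d p]
  by (simp add: label_def exchange_def forall_3 extent_vertex)

text \<open>The later point of the strand marks its birth, at the vertex \<open>L\<close>; by
  \<open>strand_in_vertex\<close> any other end is where the strand is killed.\<close>

lemma lower_end:
  assumes act: "act (max (zrank a) (zrank b)) (a, b)" and "(a, b) \<noteq> (X, Y)"
  obtains L where "L \<in> ends S {a, b}"
    "drawn L = plane (pos (a, b) (hgt (max (zrank a) (zrank b)))) (hgt (max (zrank a) (zrank b)))"
    "\<forall>V\<in>ends S {a, b}. V = L \<or> (\<exists>p. V = {a, b, p} \<and> killed (a, b) p)"
    "\<forall>p. killed (a, b) p \<longrightarrow> label L {a, b, p} = (if zrank a < zrank b then e1 else e2)"
proof -
  note A = act_D[OF act]
  have "zrank a \<noteq> zrank b"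
    using rank_tie[of a b] A strand_neq[OF A(1)] assms(2) by (auto simp: doubleton_eq_iff)
  then consider "zrank a < zrank b" | "zrank b < zrank a" by linarith
  then show thesis
  proof cases
    case 1
    then have m: "max (zrank a) (zrank b) = zrank b" by simp
    obtain c where c: "killed (a, c) b" using act_born_snd[of b a] act 1 m by auto
    show thesis
    proof (rule that[of "{a, c, b}"])
      show "{a, c, b} \<in> ends S {a, b}" unfolding ends_iff using c by blast
      show "drawn {a, c, b} = plane (pos (a, b) (hgt (max (zrank a) (zrank b))))
          (hgt (max (zrank a) (zrank b)))"
        unfolding m using drawn_killed[OF c] pos_born_snd[OF c] by simp
      show "\<forall>p. killed (a, b) p \<longrightarrow> label {a, c, b} {a, b, p} = (if zrank a < zrank b then e1 else e2)"
        using label_left[OF c] 1 by simp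
      show "\<forall>V\<in>ends S {a, b}. V = {a, c, b} \<or> (\<exists>p. V = {a, b, p} \<and> killed (a, b) p)"
      proof
        fix V assume "V \<in> ends S {a, b}"
        then obtain a' b' p where V: "V = {a', b', p}" "killed (a', b') p" "{a, b} \<subseteq> V"
          unfolding ends_iff by blast
        then have "a' = a \<and> b' = b \<or> a' = a \<and> p = b \<or> p = a \<and> b' = b"
          using strand_in_vertex[OF A(1) V(2)] by blast
        moreover have "\<not> (p = a \<and> b' = b)" using killed_D(10)[OF V(2)] 1 by auto
        ultimately show "V = {a, c, b} \<or> (\<exists>p. V = {a, b, p} \<and> killed (a, b) p)"
          using V killed_snd_unique[OF c] by blast
      qed
    qed
  next
    case 2
    then have m: "max (zrank a) (zrank b) = zrank a" by simp
    obtain c where c: "killed (c, b) a" using act_born_fst[of a b] act 2 m by auto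
    show thesis
    proof (rule that[of "{c, b, a}"])
      show "{c, b, a} \<in> ends S {a, b}" unfolding ends_iff using c by blast
      show "drawn {c, b, a} = plane (pos (a, b) (hgt (max (zrank a) (zrank b))))
          (hgt (max (zrank a) (zrank b)))"
        unfolding m using drawn_killed[OF c] pos_born_fst[OF c] by simp
      show "\<forall>p. killed (a, b) p \<longrightarrow> label {c, b, a} {a, b, p} = (if zrank a < zrank b then e1 else e2)"
        using label_right[OF c] 2 by simp
      show "\<forall>V\<in>ends S {a, b}. V = {c, b, a} \<or> (\<exists>p. V = {a, b, p} \<and> killed (a, b) p)"
      proof
        fix V assume "V \<in> ends S {a, b}"
        then obtain a' b' p where V: "V = {a', b', p}" "killed (a', b') p" "{a, b} \<subseteq> V"
          unfolding ends_iff by blast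
        then have "a' = a \<and> b' = b \<or> a' = a \<and> p = b \<or> p = a \<and> b' = b"
          using strand_in_vertex[OF A(1) V(2)] by blast
        moreover have "\<not> (a' = a \<and> p = b)" using killed_D(9)[OF V(2)] 2 by auto
        ultimately show "V = {c, b, a} \<or> (\<exists>p. V = {a, b, p} \<and> killed (a, b) p)"
          using V killed_fst_unique[OF c] by blast
      qed
    qed
  qed
qed

text \<open>The directions of the three unbounded edges. Since \<open>X\<close> and \<open>Y\<close>
  have equal rank, \<open>pos\<close> treats \<open>(X, Y)\<close> as vertical, so its ray points
  along \<open>- e2\<close>.\<close>

definition dir :: "(real ^ 3) set \<Rightarrow> real ^ 2" where
  "dir E = (if Z \<notin> E then - e2 else if X \<in> E then e1 else e2)"

lemma pos_shift: "pos s (h + k) = pos s h - (if zrank (fst s) < zrank (snd s) then k else 0)"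
  by (simp add: pos_def)

lemma plane_shift:
  "plane (pos s (h + k)) (h + k) =
     plane (pos s h) h + k *\<^sub>R (if zrank (fst s) < zrank (snd s) then e1 else e2)"
  by (simp add: pos_shift plane_def e1_eq algebra_simps)

definition drawable :: "(real ^ 3) set \<Rightarrow> bool" where
  "drawable E \<longleftrightarrow>
     (\<exists>L U. L \<noteq> U \<and> ends S E = {L, U} \<and> (\<exists>t>0. drawn U - drawn L = t *\<^sub>R label L U) \<and>
        (\<forall>w\<in>closed_segment (drawn L) (drawn U). covers E w)) \<or>
     (\<exists>V. ends S E = {V} \<and> (\<forall>w\<in>ray (drawn V) (dir E). covers E w))"

lemma drawable_finiteI:
  assumes "L \<noteq> U" "ends S E = {L, U}" "0 < t" "drawn U - drawn L = t *\<^sub>R label L U"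
    and "\<And>w. w \<in> closed_segment (drawn L) (drawn U) \<Longrightarrow> covers E w"
  shows "drawable E"
  unfolding drawable_def
  by (rule disjI1, rule exI[of _ L], rule exI[of _ U]) (use assms in auto)

lemma strand_drawable:
  assumes act: "act (max (zrank a) (zrank b)) (a, b)"
  shows "drawable {a, b}"
proof -
  define m where "m = max (zrank a) (zrank b)"
  note A = act_D[OF act]
  let ?d = "if zrank a < zrank b then e1 else e2"
  have life: "alive (a, b) h"
    if "(a, b) = (X, Y) \<or> hgt m \<le> h" "\<And>p. killed (a, b) p \<Longrightarrow> h \<le> hgt (zrank p)" for h
    using that act by (auto simp: alive_def m_def)
  \<comment> \<open>The strand \<open>(X, Y)\<close> has no lower end, a strand containing
    \<open>Z\<close> is never killed, and all others have two ends.\<close>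
  consider "(a, b) = (X, Y)" | "(a, b) \<noteq> (X, Y)" "Z \<in> {a, b}" | "(a, b) \<noteq> (X, Y)" "Z \<notin> {a, b}"
    by blast
  then show ?thesis
  proof cases
    case 1
    then have [simp]: "a = X" "b = Y" by auto
    obtain p where p: "killed (X, Y) p"
      using act_dies[OF act mem(3) x_Z_le[OF A(2)] y_Z_le[OF A(3)]] Z_neq by auto
    have "V = {X, Y, p}" if VE: "V \<in> ends S {X, Y}" for V
    proof -
      obtain a' b' p' where V: "V = {a', b', p'}" "killed (a', b') p'" "{X, Y} \<subseteq> V"
        using VE unfolding ends_iff by blast
      have "strand X Y" using A by simp
      then have "a' = X \<and> b' = Y \<or> a' = X \<and> p' = Y \<or> p' = X \<and> b' = Y"
        using strand_in_vertex[OF _ V(2)] V by blast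
      then have "a' = X \<and> b' = Y" using killed_D(5)[OF V(2)] by auto
      then show ?thesis using V killed_unique[OF p] by blast
    qed
    moreover have "{X, Y, p} \<in> ends S {X, Y}" unfolding ends_iff using p by blast
    ultimately have ends: "ends S {X, Y} = {{X, Y, p}}" by blast
    have "covers {X, Y} w" if w: "w \<in> ray (drawn {X, Y, p}) (dir {X, Y})" for w
    proof -
      obtain t where t: "t \<ge> 0" "w = drawn {X, Y, p} - t *\<^sub>R e2"
        using w Z_neq by (auto simp: ray_def dir_def)
      then have "w = plane (pos (X, Y) (hgt (zrank p) + - t)) (hgt (zrank p) + - t)"
        unfolding plane_shift using drawn_killed[OF p] by simp
      moreover have "alive (X, Y) (hgt (zrank p) + - t)"
        using life[of "hgt (zrank p) + - t"] killed_unique[OF p] t by auto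
      ultimately show ?thesis using covers_alive by metis
    qed
    then show ?thesis using ends unfolding drawable_def by auto
  next
    case 2
    obtain L where L: "L \<in> ends S {a, b}" "drawn L = plane (pos (a, b) (hgt m)) (hgt m)"
      "\<forall>V\<in>ends S {a, b}. V = L \<or> (\<exists>p. V = {a, b, p} \<and> killed (a, b) p)"
      by (rule lower_end[OF act 2(1), folded m_def])
    have nk: "\<not> killed (a, b) p" for p
      using killed_D[of a b p] rank_less_Z[of p] 2(2) by force
    then have ends: "ends S {a, b} = {L}" using L by blast
    have "m = zrank Z" using 2 rank_less_Z[of a] rank_less_Z[of b] A unfolding m_def
      by (metis insertE max.absorb1 max.absorb2 less_imp_le order_refl singletonD)
    then have "(a, b) = (X, Z) \<or> (a, b) = (Z, Y)" using act_last act m_def by metis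
    then have d: "dir {a, b} = ?d" using Z_neq X_neq_Y by (auto simp: dir_def)
    have "covers {a, b} w" if w: "w \<in> ray (drawn L) (dir {a, b})" for w
    proof -
      obtain t where t: "t \<ge> 0" "w = drawn L + t *\<^sub>R ?d"
        using w unfolding d by (auto simp: ray_def)
      then have "w = plane (pos (a, b) (hgt m + t)) (hgt m + t)"
        unfolding plane_shift L by simp
      moreover have "alive (a, b) (hgt m + t)" using life[of "hgt m + t"] nk t by auto
      ultimately show ?thesis using covers_alive by metis
    qed
    then show ?thesis using ends unfolding drawable_def by blast
  next
    case 3
    obtain L where L: "L \<in> ends S {a, b}" "drawn L = plane (pos (a, b) (hgt m)) (hgt m)"
      "\<forall>V\<in>ends S {a, b}. V = L \<or> (\<exists>p. V = {a, b, p} \<and> killed (a, b) p)"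
      "\<forall>p. killed (a, b) p \<longrightarrow> label L {a, b, p} = ?d"
      by (rule lower_end[OF act 3(1), folded m_def])
    obtain p where p: "killed (a, b) p" "m < zrank p"
      using act_dies[OF act mem(3) x_Z_le[OF A(2)] y_Z_le[OF A(3)]] 3 unfolding m_def by blast
    have "{a, b, p} \<in> ends S {a, b}" unfolding ends_iff using p by blast
    then have ends: "ends S {a, b} = {L, {a, b, p}}" using L killed_unique[OF p(1)] by blast
    define k where "k = hgt (zrank p) - hgt m"
    have k: "k > 0" "hgt (zrank p) = hgt m + k" using p by (auto simp: k_def)
    have U: "drawn {a, b, p} = drawn L + k *\<^sub>R ?d"
      unfolding drawn_killed[OF p(1)] L(2) k(2) plane_shift by simp
    then have dir: "drawn {a, b, p} - drawn L = k *\<^sub>R label L {a, b, p}" using L(4) p(1) by simp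
    have neq: "L \<noteq> {a, b, p}" using U k e_neq_0 by (auto split: if_splits)
    have "covers {a, b} w" if w: "w \<in> closed_segment (drawn L) (drawn {a, b, p})" for w
    proof -
      obtain t where t: "0 \<le> t" "t \<le> 1" "w = (1 - t) *\<^sub>R drawn L + t *\<^sub>R (drawn L + k *\<^sub>R ?d)"
        using w unfolding U in_segment by blast
      then have "w = drawn L + (t * k) *\<^sub>R ?d" by (simp add: algebra_simps)
      then have "w = plane (pos (a, b) (hgt m + t * k)) (hgt m + t * k)"
        unfolding plane_shift L by simp
      moreover have "alive (a, b) (hgt m + t * k)"
      proof (rule life)
        fix p' assume "killed (a, b) p'"
        then have "p' = p" using killed_unique[OF p(1)] by blast
        then show "hgt m + t * k \<le> hgt (zrank p')" using t k by (simp add: mult_left_le_one_le)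
      qed (use t k in simp)
      ultimately show ?thesis using covers_alive by metis
    qed
    then show ?thesis by (rule drawable_finiteI[OF neq ends k(1) dir])
  qed
qed

lemma horizontal_drawable:
  assumes "p \<in> vrm S" "q \<in> vrm S" "p $ 1 < q $ 1" "p $ 2 < q $ 2"
    and "\<And>c. \<lbrakk>c \<in> vrm S; zrank c \<le> zrank p; c $ 1 \<le> q $ 1; c $ 2 \<le> q $ 2\<rbrakk> \<Longrightarrow> c = p \<or> c = q"
  shows "drawable {q, p}"
proof -
  obtain c d where k: "killed (c, q) p" "killed (q, d) p"
    using horizontal_ends[of p q] assms by blast
  note K = killed_D[OF k(1)] killed_D[OF k(2)]
  let ?h = "hgt (zrank p)"
  have "{c, q, p} \<in> ends S {q, p}" "{q, d, p} \<in> ends S {q, p}" unfolding ends_iff using k by blast+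
  moreover have "V = {c, q, p} \<or> V = {q, d, p}" if VE: "V \<in> ends S {q, p}" for V
  proof -
    obtain a' b' p' where V: "V = {a', b', p'}" "killed (a', b') p'" "{q, p} \<subseteq> V"
      using VE unfolding ends_iff by blast
    then have "p' = p \<and> (b' = q \<or> a' = q)"
      using horizontal_in_vertex[OF assms(3,4) V(2)] by blast
    then consider "p' = p" "b' = q" | "p' = p" "a' = q" by blast
    then show ?thesis
    proof cases
      case 1
      then show ?thesis using V killed_fst_unique[OF k(1)] by blast
    next
      case 2
      then show ?thesis using V killed_snd_unique[OF k(2)] by blast
    qed
  qed
  ultimately have ends: "ends S {q, p} = {{c, q, p}, {q, d, p}}" by blast
  have "zrank p \<le> zrank Z" using rank_less_Z assms(1) by (metis less_imp_le order_refl)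
  then have "slot (zrank p - 1) ?h" using K(5) by (auto simp: slot_def)
  moreover have "le (c, q) (q, d)" "(c, q) \<noteq> (q, d)" using K by (auto simp: le_def)
  ultimately have less: "pos (c, q) ?h < pos (q, d) ?h"
    using pos_less[OF K(1) K(16)] by blast
  define k' where "k' = pos (q, d) ?h - pos (c, q) ?h"
  have U: "drawn {q, d, p} = drawn {c, q, p} + k' *\<^sub>R e3"
    unfolding drawn_killed[OF k(1)] drawn_killed[OF k(2)] by (simp add: plane_def k'_def algebra_simps)
  then have dir: "drawn {q, d, p} - drawn {c, q, p} = k' *\<^sub>R label {c, q, p} {q, d, p}"
    unfolding label_horizontal[OF k] by simp
  have "0 < k'" using less by (simp add: k'_def)
  have "covers {q, p} w" if w: "w \<in> closed_segment (drawn {c, q, p}) (drawn {q, d, p})" for w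
  proof -
    obtain t where t: "0 \<le> t" "t \<le> 1"
      "w = (1 - t) *\<^sub>R drawn {c, q, p} + t *\<^sub>R (drawn {c, q, p} + k' *\<^sub>R e3)"
      using w unfolding U in_segment by blast
    then have "w = drawn {c, q, p} + (t * k') *\<^sub>R e3" by (simp add: algebra_simps)
    then have "w = plane (pos (c, q) ?h + t * k') ?h"
      unfolding drawn_killed[OF k(1)] by (simp add: plane_def algebra_simps)
    moreover have "0 \<le> t * k'" "t * k' \<le> k'"
      using t \<open>0 < k'\<close> by (auto simp: mult_left_le_one_le)
    then have "meets r ?h {q, p} (pos (c, q) ?h + t * k')" if "slot r ?h" for r
      using horizontal_meets[OF k _ _ that] by (simp add: k'_def)
    moreover have "0 < ?h" using K(5) hgt_less_iff[of 0 "zrank p"] by (simp add: hgt_def)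
    ultimately show ?thesis unfolding covers_def by blast
  qed
  moreover have "{c, q, p} \<noteq> {q, d, p}"
    using killed_vertex_inj[OF k] K(6) by blast
  ultimately show ?thesis using drawable_finiteI[OF _ ends \<open>0 < k'\<close> dir] by blast
qed

lemma edge_drawable: "E \<in> MV_edges S \<Longrightarrow> drawable E"
  by (erule edge_cases) (use strand_drawable horizontal_drawable in blast)+

text \<open>The ends form an unordered set; the convex hull gives the segment without choosing an
  orientation.\<close>

definition image :: "(real ^ 3) set \<Rightarrow> (real ^ 2) set" where
  "image E = (if card (ends S E) = 1 then ray (drawn (the_elem (ends S E))) (dir E)
     else convex hull (drawn ` ends S E))"

lemma image_infinite: "ends S E = {V} \<Longrightarrow> image E = ray (drawn V) (dir E)"
  by (simp add: image_def)

lemma image_finite: "ends S E = {V, V'} \<Longrightarrow> V \<noteq> V' \<Longrightarrow> image E = closed_segment (drawn V) (drawn V')"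
  by (simp add: image_def segment_convex_hull)

lemma image_covers: "\<lbrakk>E \<in> MV_edges S; w \<in> image E\<rbrakk> \<Longrightarrow> covers E w"
  using edge_drawable[of E] image_infinite[of E] image_finite[of E] unfolding drawable_def by metis

lemma drawn_in_image:
  assumes "E \<in> MV_edges S" "V \<in> MV_vertices S" "drawn V \<in> image E" shows "V \<in> ends S E"
proof -
  obtain a b p where V: "V = {a, b, p}" and k: "killed (a, b) p" using assms(2) vertex_iff by blast
  let ?h = "hgt (zrank p)"
  have pos: "0 < ?h" using killed_D(5)[OF k] hgt_less_iff[of 0 "zrank p"] by (simp add: hgt_def)
  then obtain t where t: "slot t ?h" using slot_exists by blast
  have "covers E (plane (pos (a, b) ?h) ?h)"
    using image_covers[OF assms(1,3)] drawn_killed[OF k] V by simp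
  then have "meets t ?h E (pos (a, b) ?h)"
    using t pos unfolding covers_def plane_eq_iff by auto
  then have "E \<subseteq> V" using meets_vertex[OF _ k] V by simp
  then show ?thesis unfolding ends_iff using V k by blast
qed

text \<open>The height determines \<open>p\<close>, and in the slot that \<open>p\<close> closes the
  abscissa determines the strand.\<close>

lemma drawn_inj: "inj_on drawn (MV_vertices S)"
proof (rule inj_onI)
  fix V V' assume "V \<in> MV_vertices S" "V' \<in> MV_vertices S" and eq: "drawn V = drawn V'"
  then obtain a b p a' b' p' where V: "V = {a, b, p}" "killed (a, b) p"
    and V': "V' = {a', b', p'}" "killed (a', b') p'" using vertex_iff by meson
  note K = killed_D[OF V(2)] killed_D[OF V'(2)]
  have "pos (a, b) (hgt (zrank p)) = pos (a', b') (hgt (zrank p'))" "zrank p = zrank p'"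
    using eq drawn_killed[OF V(2)] drawn_killed[OF V'(2)] V V' plane_eq_iff by auto
  moreover from this have "p = p'" using rank_inj K by blast
  moreover have "zrank p \<le> zrank Z" using rank_less_Z K(4) by (metis less_imp_le order_refl)
  then have "slot (zrank p - 1) (hgt (zrank p))" using K(5) by (auto simp: slot_def)
  ultimately have "(a, b) = (a', b')" using pos_inj K(1,16) by metis
  then show "V = V'" using V V' \<open>p = p'\<close> by simp
qed

lemma canonical: "canonical_diagram S drawn image"
  unfolding canonical_diagram_def
proof (intro conjI ballI allI impI)
  show "inj_on drawn (MV_vertices S)" by (rule drawn_inj)
  show "(\<exists>V V'. finite_edge S E V V') \<or> (\<exists>V. infinite_edge S E V)" if "E \<in> MV_edges S" for E
    using edge_drawable[OF that] that unfolding drawable_def finite_edge_def infinite_edge_def by metis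
  show "image E = closed_segment (drawn V) (drawn V')" if "finite_edge S E V V'" for E V V'
    using that image_finite unfolding finite_edge_def by blast
  show "\<exists>t>0. drawn V' - drawn V = t *\<^sub>R label V V'" if f: "finite_edge S E V V'" for E V V'
  proof -
    have E: "E \<in> MV_edges S" "V \<noteq> V'" "ends S E = {V, V'}" using f by (auto simp: finite_edge_def)
    then obtain L U t where LU: "ends S E = {L, U}" "t > 0" "drawn U - drawn L = t *\<^sub>R label L U"
      using edge_drawable[OF E(1)] unfolding drawable_def by (metis doubleton_eq_iff insert_absorb2)
    then have "drawn L - drawn U = t *\<^sub>R label U L"
      unfolding label_swap[of U L] by (metis minus_diff_eq scaleR_minus_right)
    then show ?thesis using LU E by (metis doubleton_eq_iff)
  qed
  show "\<exists>d. d \<noteq> 0 \<and> image E = ray (drawn V) d" if "infinite_edge S E V" for E V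
  proof -
    have "dir E \<noteq> 0" using e_neq_0 by (auto simp: dir_def)
    then show ?thesis using that image_infinite[of E V] unfolding infinite_edge_def by blast
  qed
  show "V \<in> ends S E" if "E \<in> MV_edges S" "V \<in> MV_vertices S" "drawn V \<in> image E" for E V
    using drawn_in_image that by blast
  show "image E \<inter> image E' \<subseteq> drawn ` (ends S E \<inter> ends S E')"
    if E: "E \<in> MV_edges S" "E' \<in> MV_edges S" "E \<noteq> E'" for E E'
  proof
    fix w assume w: "w \<in> image E \<inter> image E'"
    then have "covers E w" "covers E' w" using image_covers E by blast+
    then obtain u h where uh: "w = plane u h"
      "h \<le> 0 \<and> E = {X, Y} \<or> 0 < h \<and> (\<forall>t. slot t h \<longrightarrow> meets t h E u)"
      "h \<le> 0 \<and> E' = {X, Y} \<or> 0 < h \<and> (\<forall>t. slot t h \<longrightarrow> meets t h E' u)"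
      unfolding covers_def by (metis plane_eq_iff)
    \<comment> \<open>At heights up to 0 both edges would be \<open>{X, Y}\<close>.\<close>
    then have "0 < h" using E(3) by auto
    then obtain t where "slot t h" using slot_exists by blast
    then have "meets t h E u" "meets t h E' u" using uh \<open>0 < h\<close> by auto
    then obtain s p where s: "killed s p" "h = hgt (zrank p)" "u = pos s h"
      using meets_common E(3) by metis
    define V where "V = {fst s, snd s, p}"
    have k: "killed (fst s, snd s) p" using s by simp
    then have V: "V \<in> MV_vertices S" unfolding vertex_iff V_def by blast
    have "w = drawn V" using drawn_killed[OF k] s uh V_def by simp
    then show "w \<in> drawn ` (ends S E \<inter> ends S E')"
      using drawn_in_image[OF _ V] E w by blast
  qed
qed

end

section \<open>Naming the points on the axes\<close>

lemma generic_set_exists: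
  assumes "finite S" "S \<subseteq> nonneg_orthant" "axial S" "general_position S"
  obtains X Y Z where "generic_set S X Y Z"
proof -
  have nonneg: "0 \<le> p $ i" if "p \<in> S" for p i
    using assms(2) that by (auto simp: nonneg_orthant_def)
  have "\<forall>i. \<exists>p. p \<in> S \<and> p \<in> range (axis i)" using assms(3) by (auto simp: axial_def)
  then obtain A where A: "\<And>i. A i \<in> S" "\<And>i. A i \<in> range (axis i)" by metis
  have plane: "\<exists>p q. {r \<in> S. r $ i = 0} = {p, q} \<and> p \<noteq> 0 \<and> q \<noteq> 0" for i
    using assms(4) unfolding general_position_def by metis
  have A0: "A i $ j = 0" if "j \<noteq> i" for i j
    using A(2)[of i] that by (auto simp: axis_def)
  have Apos: "0 < A i $ i" for i
  proof -
    have "A i $ i \<noteq> 0"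
    proof
      assume 0: "A i $ i = 0"
      then have "A i = 0" using A0[of _ i] unfolding vec_eq_iff by (metis zero_index)
      moreover have "A i \<in> {r \<in> S. r $ i = 0}" using A(1) 0 by simp
      ultimately show False using plane[of i] by (metis insertE singletonD)
    qed
    then show ?thesis using nonneg[OF A(1), of i i] by simp
  qed
  \<comment> \<open>The two axis points \<open>A j\<close> and \<open>A k\<close> are distinct and
    lie in this coordinate plane, so they exhaust its two points.\<close>
  have on_plane: "p = A j \<or> p = A k" if "p \<in> S" "p $ i = 0" "i \<noteq> j" "i \<noteq> k" "j \<noteq> k" for p i j k
  proof -
    obtain q r where qr: "{r \<in> S. r $ i = 0} = {q, r}" using plane by blast
    have "A j \<in> {q, r}" "A k \<in> {q, r}" "p \<in> {q, r}"
      unfolding qr[symmetric] using A(1) A0 that by auto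
    moreover have "A j \<noteq> A k" using Apos[of j] A0[of j k] that by auto
    ultimately show ?thesis by auto
  qed
  have "generic_set S (A 1) (A 2) (A 3)"
  proof
    show "finite S" by fact
    show "p = q" if "p \<in> S" "q \<in> S" "p $ i = q $ i" "p $ i \<noteq> 0" for p q i
      using assms(4)[unfolded general_position_def, THEN conjunct2] that by metis
    show "p = A 2 \<or> p = A 3" if "p \<in> S" "p $ 1 = 0" for p
      by (rule on_plane[OF that]) auto
    show "p = A 1 \<or> p = A 3" if "p \<in> S" "p $ 2 = 0" for p
      by (rule on_plane[OF that]) auto
    show "p = A 1 \<or> p = A 2" if "p \<in> S" "p $ 3 = 0" for p
      by (rule on_plane[OF that]) auto
  qed (simp_all add: nonneg A Apos A0)
  then show thesis by (rule that)
qed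

theorem theorem3p1:
  fixes S :: "(real ^ 3) set"
  assumes "finite S"
    and "S \<subseteq> nonneg_orthant"
    and "axial S"
    and "general_position S"
  shows "\<exists>f D. canonical_diagram S f D"
proof -
  obtain X Y Z where "generic_set S X Y Z" using generic_set_exists assms by blast
  then interpret generic_set S X Y Z .
  obtain \<phi>\<^sub>1 \<phi>\<^sub>2 :: "real ^ 3 \<Rightarrow> real" where
    "\<And>a b p. killed (a, b) p \<Longrightarrow> \<phi>\<^sub>1 a + \<phi>\<^sub>2 b + hgt (zrank p) = 0"
    using levels_exist by blast
  then interpret leveled_set S X Y Z \<phi>\<^sub>1 \<phi>\<^sub>2
    by unfold_locales
  show ?thesis using canonical by blast
qed

end
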